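(* Let $\theta$ be a regular infinite cardinal, let $\tau$ be either $\tau_R$ for a ring $R$, or an arbitrary $\theta$-additive vocabulary, and let $M$ be respectively a (left) $R$-module, or a $\theta$-additive structure with vocabulary $\tau$. Let $\gamma^*$ be a limit ordinal, $\kappa_{\gamma^*}=\beth_{\gamma^*}(|\tau|+\theta^-)$, and $\Phi\subseteq\Lambda^{\mathrm{pe}}_{\gamma^*}(\tau)$. If $\varepsilon<\theta$, $\lambda$ and $\mu$ are cardinals with $\lambda=\mathrm{cf}(\lambda)>\mu\ge\kappa_{\gamma^*}$, $|i|^{\kappa_{\gamma^*}}<\lambda$ for every $i<\lambda$, and $\langle\bar a_i:i<\lambda\rangle\subseteq{}^{\varepsilon}M$ is without repetition, then for some stationary $S\subseteq\lambda$ the set $\{\bar a_i:i\in S\}$ is $(\mu^+,\Phi)$-convergent.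
   Context: Sequences. $\mathrm{lh}(\bar x)$ is the length (an ordinal) of a sequence; ${}^{\varepsilon}M$ is the set of sequences of length $\varepsilon$ from $M$. Differences of sequences of equal length are coordinatewise. $\bar a^\frown\bar b$ is concatenation. $\theta^-$ is $\sigma$ if $\theta=\sigma^+$, and $\theta$ if $\theta$ is a limit cardinal. $\beth_0(\mu)=\mu$, $\beth_{\beta+1}(\mu)=2^{\beth_\beta(\mu)}$, suprema at limits. Vocabularies. A vocabulary consists of function symbols and predicates, each with an arity which may be an infinite ordinal; function symbols may be interpreted as partial functions (an atomic formula containing an undefined term is false). A vocabulary $\tau$ is $\theta$-additive if it contains binary function symbols $+,-$, an individual constant $0$, and all its other symbols have arity $<\theta$. A $\theta$-additive structure $M$ is a structure with $\theta$-additive vocabulary $\tau$ such that: $G_M=(|M|,+^M,-^M,0^M)$ is an Abelian group; for each $\varepsilon$-place predicate $P\in\tau$, $P^M$ is a subgroup of $(G_M)^\varepsilon$; for each $\varepsilon$-place function symbol $F\in\tau\setminus\{+,-,0\}$, $F^M$ is a partial $\varepsilon$-place function whose graph is a subgroup of $(G_M)^{\varepsilon+1}$. For a ring $R$, $\tau_R$ consists of $+,-,0$ and a unary function symbol $F_a$ (left multiplication by $a$) for each $a\in R$; an $R$-module is viewed as a $\tau_R$-structure. The sets $\Lambda^{\mathrm{pe}}_{\alpha,\varepsilon}(\tau)$, for $\varepsilon<\theta$ and $\alpha$ an ordinal, consist of formulas $\varphi(\bar x)$ of the infinitary logic $\mathbb{L}_{\infty,\theta}(\tau)$ with $\mathrm{lh}(\bar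 x)=\varepsilon$ and are defined by induction on $\alpha$. For $\zeta<\theta$, $\Lambda^{\mathrm{pe}}_{\alpha,\varepsilon,\zeta}$ is the set of $\varphi(\bar x,\bar y)$ with $\mathrm{lh}(\bar x)=\varepsilon$, $\mathrm{lh}(\bar y)=\zeta$ and $\varphi\in\Lambda^{\mathrm{pe}}_{\alpha,\varepsilon+\zeta}$; and $\Lambda^{\mathrm{pe}}_{\alpha}=\bigcup_{\varepsilon<\theta}\Lambda^{\mathrm{pe}}_{\alpha,\varepsilon}$. - $\alpha=0$: for $R$-modules, $\Lambda^{\mathrm{pe}}_{0,\varepsilon}$ is the set of formulas $\sum_{\zeta<\varepsilon}a_\zeta x_\zeta=0$ with $a_\zeta\in R$, all but finitely many equal to $0$. For general $\tau$, it is the set of formulas $P(\bar\sigma(\bar x))$, where $P$ is equality or a predicate of $\tau$ and $\bar\sigma$ is a sequence of $\tau$-terms in the variables $\bar x$ of length the arity of $P$. - $\alpha$ limit: $\Lambda^{\mathrm{pe}}_{\alpha,\varepsilon}=\bigcup_{\beta<\alpha}\Lambda^{\mathrm{pe}}_{\beta,\varepsilon}$. - $\alpha=\beta+1$: $\Lambda^{\mathrm{pe}}_{\alpha,\varepsilon}$ is $\Lambda^{\mathrm{pe}}_{\beta,\varepsilon}$ together with all formulas $(\exists\bar y)\bigwedge\{\varphi(\bar x,\bar y):\varphi\in\Phi'\}$ where $\zeta<\theta$, $\mathrm{lh}(\bar y)=\zeta$ and $\Phi'\subseteq\Lambda^{\mathrm{pe}}_{\beta,\varepsilon,\zeta}$.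 For $\varphi(\bar x)$ with $\mathrm{lh}(\bar x)=\eta$, $\varphi(M)=\{\bar b\in{}^{\eta}M:M\models\varphi[\bar b]\}$. Convergence. A set $\mathbf{I}\subseteq{}^{\varepsilon}M$ is $(\chi,\Phi)$-convergent when $|\mathbf{I}|\ge\chi$ and for every $\xi<\theta$, every $\varphi\in\Phi\cap\Lambda^{\mathrm{pe}}_{\gamma^*,\varepsilon+\xi}$, every $\bar b\in{}^{\xi}M$ and every $\bar c\in{}^{\varepsilon+\xi}M$, for all but fewer than $\chi$ of the $\bar a\in\mathbf{I}$ the truth value of "$\bar a^\frown\bar b-\bar c\in\varphi(M)$" is constant. *)

theory Defs
  imports "HOL-Algebra.Product_Groups" "HOL-Algebra.Module"
begin

unbundle cardinal_syntax

section \<open>Ordinals and cardinals\<close>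

text \<open>
  Ordinals are the elements of an arbitrary type of class \<^class>\<open>wellorder\<close>; the ordinal
  \<open>\<alpha>\<close> is identified with its set of predecessors \<open>{..<\<alpha>}\<close>.  Such a type may be too short for a
  given ordinal to have a successor, a sum or a power-set cardinal, so these notions are given
  relationally or are only applied where the value exists.
  \<open>ord_rel \<alpha>\<close> makes the well-order and cardinal theory of the library applicable to \<open>\<alpha>\<close>.
\<close>

definition ord_rel :: "'o::wellorder \<Rightarrow> 'o rel"
  where "ord_rel \<alpha> = {(x, y). x \<le> y \<and> y < \<alpha>}"

definition cardinal :: "'o::wellorder \<Rightarrow> bool"
  where "cardinal \<kappa> \<longleftrightarrow> Card_order (ord_rel \<kappa>)"

definition regular_cardinal :: "'o::wellorder \<Rightarrow> bool"
  where "regular_cardinal \<kappa> \<longleftrightarrow>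
    cardinal \<kappa> \<and> infinite {..<\<kappa>} \<and> regularCard (ord_rel \<kappa>)"

definition ozero :: "'o::wellorder"
  where "ozero = (LEAST \<alpha>. True)"

definition oone :: "'o::wellorder"
  where "oone = (LEAST \<alpha>. ozero < \<alpha>)"

definition is_succ :: "'o::wellorder \<Rightarrow> 'o \<Rightarrow> bool"
  where "is_succ \<beta> \<alpha> \<longleftrightarrow> \<beta> < \<alpha> \<and> (\<forall>\<delta>. \<beta> < \<delta> \<longrightarrow> \<alpha> \<le> \<delta>)"

definition is_limit :: "'o::wellorder \<Rightarrow> bool"
  where "is_limit \<alpha> \<longleftrightarrow> \<alpha> \<noteq> ozero \<and> (\<forall>\<beta><\<alpha>. \<exists>\<delta>. \<beta> < \<delta> \<and> \<delta> < \<alpha>)"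

text \<open>
  Ordinal sum: the least ordinal that is \<open>\<ge> \<epsilon>\<close> and \<open>> \<epsilon> + \<zeta>'\<close> for all \<open>\<zeta>' < \<zeta>\<close>.  It is only applied
  to ordinals below an infinite cardinal, where the least element exists.
\<close>

function oadd :: "'o::wellorder \<Rightarrow> 'o \<Rightarrow> 'o"
  where "oadd \<epsilon> \<zeta> = (LEAST \<delta>. \<epsilon> \<le> \<delta> \<and> (\<forall>\<zeta>'\<in>{..<\<zeta>}. oadd \<epsilon> \<zeta>' < \<delta>))"
  by pat_completeness auto
termination by (relation "{((\<epsilon>, \<zeta>'), (\<epsilon>, \<zeta>)) |\<epsilon> \<zeta>' \<zeta>. \<zeta>' < \<zeta>}")
  (auto intro: wf_subset[OF wf_inv_image[OF wf, of snd]] simp: inv_image_def)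

declare oadd.simps [simp del]

text \<open>\<open>\<theta>\<^sup>-\<close>\<close>

definition card_pred :: "'o::wellorder \<Rightarrow> 'o"
  where "card_pred \<theta> =
    (if \<exists>\<sigma>::'o. cardinal \<sigma> \<and> ord_rel \<theta> =o cardSuc (ord_rel \<sigma>)
     then THE \<sigma>::'o. cardinal \<sigma> \<and> ord_rel \<theta> =o cardSuc (ord_rel \<sigma>)
     else \<theta>)"

text \<open>\<open>is_beth r \<alpha> \<kappa>\<close>: the cardinal \<open>\<beth>\<^sub>\<alpha>(r)\<close> exists in the type of ordinals and equals \<open>\<kappa>\<close>.\<close>

inductive is_beth :: "'x rel \<Rightarrow> 'o::wellorder \<Rightarrow> 'o \<Rightarrow> bool" for r :: "'x rel"
  where
    zero: "cardinal \<kappa> \<Longrightarrow> ord_rel \<kappa> =o r \<Longrightarrow> is_beth r ozero \<kappa>"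
  | succ: "is_succ \<beta> \<alpha> \<Longrightarrow> is_beth r \<beta> \<kappa> \<Longrightarrow> cardinal \<kappa>' \<Longrightarrow> ord_rel \<kappa>' =o ctwo ^c ord_rel \<kappa>
      \<Longrightarrow> is_beth r \<alpha> \<kappa>'"
  | limit: "is_limit \<alpha> \<Longrightarrow> \<forall>\<beta><\<alpha>. is_beth r \<beta> (b \<beta>) \<Longrightarrow>
      \<forall>\<beta><\<alpha>. b \<beta> \<le> \<kappa> \<Longrightarrow> \<forall>\<delta><\<kappa>. \<exists>\<beta><\<alpha>. \<delta> < b \<beta> \<Longrightarrow> is_beth r \<alpha> \<kappa>"

definition club :: "'o::wellorder \<Rightarrow> 'o set \<Rightarrow> bool"
  where "club \<kappa> C \<longleftrightarrow> C \<subseteq> {..<\<kappa>} \<and> (\<forall>i<\<kappa>. \<exists>j\<in>C. i < j) \<and>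
    (\<forall>\<delta><\<kappa>. is_limit \<delta> \<and> (\<forall>i<\<delta>. \<exists>j\<in>C. i < j \<and> j < \<delta>) \<longrightarrow> \<delta> \<in> C)"

definition stationary :: "'o::wellorder \<Rightarrow> 'o set \<Rightarrow> bool"
  where "stationary \<kappa> S \<longleftrightarrow> S \<subseteq> {..<\<kappa>} \<and> (\<forall>C. club \<kappa> C \<longrightarrow> S \<inter> C \<noteq> {})"


section \<open>Sequences\<close>

text \<open>Sequences of length \<open>\<epsilon>\<close> are functions on \<open>{..<\<epsilon>}\<close>, extended by \<^const>\<open>undefined\<close>.\<close>

definition seqs :: "'o::wellorder \<Rightarrow> 'a set \<Rightarrow> ('o \<Rightarrow> 'a) set"
  where "seqs \<epsilon> A = {..<\<epsilon>} \<rightarrow>\<^sub>E A"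

definition seq_append :: "'o::wellorder \<Rightarrow> 'o \<Rightarrow> ('o \<Rightarrow> 'a) \<Rightarrow> ('o \<Rightarrow> 'a) \<Rightarrow> 'o \<Rightarrow> 'a"
  where "seq_append \<epsilon> \<xi> a b =
    (\<lambda>i\<in>{..<oadd \<epsilon> \<xi>}. if i < \<epsilon> then a i else b (THE j. j < \<xi> \<and> oadd \<epsilon> j = i))"


section \<open>Vocabularies and structures\<close>

text \<open>
  Every vocabulary considered contains \<open>+\<close>, \<open>-\<close> and \<open>0\<close>; the record lists the remaining symbols
  and their arities.
\<close>

record ('o, 'f, 'p) vocab =
  funs :: "'f set"
  preds :: "'p set"
  fun_arity :: "'f \<Rightarrow> 'o"
  pred_arity :: "'p \<Rightarrow> 'o"

datatype ('f, 'p) symbol = Plus_sym | Minus_sym | Zero_sym | Fun_sym 'f | Pred_sym 'p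

definition symbols :: "('o, 'f, 'p) vocab \<Rightarrow> ('f, 'p) symbol set"
  where "symbols \<tau> =
    {Plus_sym, Minus_sym, Zero_sym} \<union> Fun_sym ` funs \<tau> \<union> Pred_sym ` preds \<tau>"

definition additive_vocab :: "'o::wellorder \<Rightarrow> ('o, 'f, 'p) vocab \<Rightarrow> bool"
  where "additive_vocab \<theta> \<tau> \<longleftrightarrow>
    (\<forall>F\<in>funs \<tau>. fun_arity \<tau> F < \<theta>) \<and> (\<forall>P\<in>preds \<tau>. pred_arity \<tau> P < \<theta>)"

text \<open>Partial functions return \<^const>\<open>None\<close> where they are undefined.\<close>

record ('o, 'f, 'p, 'm) struct =
  universe :: "'m set"
  plus_int :: "'m \<Rightarrow> 'm \<Rightarrow> 'm"
  minus_int :: "'m \<Rightarrow> 'm \<Rightarrow> 'm"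
  zero_int :: "'m"
  fun_int :: "'f \<Rightarrow> ('o \<Rightarrow> 'm) \<Rightarrow> 'm option"
  pred_int :: "'p \<Rightarrow> ('o \<Rightarrow> 'm) set"

definition group_of :: "('o, 'f, 'p, 'm) struct \<Rightarrow> 'm monoid"
  where "group_of M = \<lparr>carrier = universe M, monoid.mult = plus_int M, one = zero_int M\<rparr>"

text \<open>The graph of an \<open>\<epsilon>\<close>-place partial function, as a set of sequences of length \<open>\<epsilon> + 1\<close>.\<close>

definition fun_graph :: "'o::wellorder \<Rightarrow> 'm set \<Rightarrow> (('o \<Rightarrow> 'm) \<Rightarrow> 'm option) \<Rightarrow> ('o \<Rightarrow> 'm) set"
  where "fun_graph \<epsilon> A F = {s \<in> {..\<epsilon>} \<rightarrow>\<^sub>E A. F (restrict s {..<\<epsilon>}) = Some (s \<epsilon>)}"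

definition additive_struct :: "('o::wellorder, 'f, 'p) vocab \<Rightarrow> ('o, 'f, 'p, 'm) struct \<Rightarrow> bool"
  where "additive_struct \<tau> M \<longleftrightarrow>
    comm_group (group_of M) \<and>
    (\<forall>x\<in>universe M. \<forall>y\<in>universe M. minus_int M x y = plus_int M x (inv\<^bsub>group_of M\<^esub> y)) \<and>
    (\<forall>P\<in>preds \<tau>.
       subgroup (pred_int M P) (product_group {..<pred_arity \<tau> P} (\<lambda>_. group_of M))) \<and>
    (\<forall>F\<in>funs \<tau>.
       (\<forall>s y. fun_int M F s = Some y \<longrightarrow> s \<in> seqs (fun_arity \<tau> F) (universe M) \<and> y \<in> universe M) \<and>
       subgroup (fun_graph (fun_arity \<tau> F) (universe M) (fun_int M F))
         (product_group {..fun_arity \<tau> F} (\<lambda>_. group_of M)))"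

text \<open>The library locale \<^locale>\<open>module\<close> requires a commutative ring.\<close>

locale left_module = R?: ring R + M?: abelian_group M
  for R :: "('r, 'c) ring_scheme" (structure) and M :: "('r, 'm, 'd) module_scheme" (structure) +
  assumes smult_closed:
      "a \<in> carrier R \<Longrightarrow> x \<in> carrier M \<Longrightarrow> a \<odot>\<^bsub>M\<^esub> x \<in> carrier M"
    and smult_l_distr:
      "a \<in> carrier R \<Longrightarrow> b \<in> carrier R \<Longrightarrow> x \<in> carrier M \<Longrightarrow>
        (a \<oplus>\<^bsub>R\<^esub> b) \<odot>\<^bsub>M\<^esub> x = a \<odot>\<^bsub>M\<^esub> x \<oplus>\<^bsub>M\<^esub> b \<odot>\<^bsub>M\<^esub> x"
    and smult_r_distr:
      "a \<in> carrier R \<Longrightarrow> x \<in> carrier M \<Longrightarrow> y \<in> carrier M \<Longrightarrow>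
        a \<odot>\<^bsub>M\<^esub> (x \<oplus>\<^bsub>M\<^esub> y) = a \<odot>\<^bsub>M\<^esub> x \<oplus>\<^bsub>M\<^esub> a \<odot>\<^bsub>M\<^esub> y"
    and smult_assoc:
      "a \<in> carrier R \<Longrightarrow> b \<in> carrier R \<Longrightarrow> x \<in> carrier M \<Longrightarrow>
        (a \<otimes>\<^bsub>R\<^esub> b) \<odot>\<^bsub>M\<^esub> x = a \<odot>\<^bsub>M\<^esub> (b \<odot>\<^bsub>M\<^esub> x)"
    and smult_one:
      "x \<in> carrier M \<Longrightarrow> \<one>\<^bsub>R\<^esub> \<odot>\<^bsub>M\<^esub> x = x"

text \<open>\<open>\<tau>\<^sub>R\<close>: the ring element \<open>a\<close> itself serves as the unary function symbol \<open>F\<^sub>a\<close>.\<close>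

definition module_vocab :: "'f ring \<Rightarrow> ('o::wellorder, 'f, 'p) vocab"
  where "module_vocab R =
    \<lparr>funs = carrier R, preds = {}, fun_arity = (\<lambda>_. oone), pred_arity = (\<lambda>_. ozero)\<rparr>"

definition module_struct :: "('f, 'm) module \<Rightarrow> ('o::wellorder, 'f, 'p, 'm) struct"
  where "module_struct N =
    \<lparr>universe = carrier N,
     plus_int = (\<lambda>x y. x \<oplus>\<^bsub>N\<^esub> y),
     minus_int = (\<lambda>x y. x \<ominus>\<^bsub>N\<^esub> y),
     zero_int = \<zero>\<^bsub>N\<^esub>,
     fun_int = (\<lambda>a s. if s \<in> seqs oone (carrier N) then Some (a \<odot>\<^bsub>N\<^esub> s ozero) else None),
     pred_int = (\<lambda>_. {})\<rparr>"


section \<open>Infinitary formulas\<close>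

text \<open>
  Variables are indexed by ordinals.  Conjunctions are taken over families indexed by a set of
  elements of the type \<open>'i\<close>; the size of conjunctions is bounded only by the choice of \<open>'i\<close>.
  Quantifiers bind a set of variables.
\<close>

datatype ('o, 'f) trm =
    Var 'o
  | Zero
  | Plus "('o, 'f) trm" "('o, 'f) trm"
  | Minus "('o, 'f) trm" "('o, 'f) trm"
  | Fn 'f "'o \<Rightarrow> ('o, 'f) trm"

datatype ('o, 'f, 'p, 'i) fm =
    Eq "('o, 'f) trm" "('o, 'f) trm"
  | Rel 'p "'o \<Rightarrow> ('o, 'f) trm"
  | Neg "('o, 'f, 'p, 'i) fm"
  | Conj "'i set" "'i \<Rightarrow> ('o, 'f, 'p, 'i) fm"
  | Exists "'o set" "('o, 'f, 'p, 'i) fm"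

primrec eval :: "('o::wellorder, 'f, 'p) vocab \<Rightarrow> ('o, 'f, 'p, 'm) struct \<Rightarrow>
    ('o \<Rightarrow> 'm) \<Rightarrow> ('o, 'f) trm \<Rightarrow> 'm option"
  where
    "eval \<tau> M s (Var i) = Some (s i)"
  | "eval \<tau> M s Zero = Some (zero_int M)"
  | "eval \<tau> M s (Plus t u) = (case (eval \<tau> M s t, eval \<tau> M s u) of
        (Some x, Some y) \<Rightarrow> Some (plus_int M x y) | _ \<Rightarrow> None)"
  | "eval \<tau> M s (Minus t u) = (case (eval \<tau> M s t, eval \<tau> M s u) of
        (Some x, Some y) \<Rightarrow> Some (minus_int M x y) | _ \<Rightarrow> None)"
  | "eval \<tau> M s (Fn F ts) =
        (if \<forall>i<fun_arity \<tau> F. eval \<tau> M s (ts i) \<noteq> None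
         then fun_int M F (\<lambda>i\<in>{..<fun_arity \<tau> F}. the (eval \<tau> M s (ts i)))
         else None)"

primrec sat :: "('o::wellorder, 'f, 'p) vocab \<Rightarrow> ('o, 'f, 'p, 'm) struct \<Rightarrow>
    ('o, 'f, 'p, 'i) fm \<Rightarrow> ('o \<Rightarrow> 'm) \<Rightarrow> bool"
  where
    "sat \<tau> M (Eq t u) s = (eval \<tau> M s t \<noteq> None \<and> eval \<tau> M s t = eval \<tau> M s u)"
  | "sat \<tau> M (Rel P ts) s =
        ((\<forall>i<pred_arity \<tau> P. eval \<tau> M s (ts i) \<noteq> None) \<and>
         (\<lambda>i\<in>{..<pred_arity \<tau> P}. the (eval \<tau> M s (ts i))) \<in> pred_int M P)"
  | "sat \<tau> M (Neg \<phi>) s = (\<not> sat \<tau> M \<phi> s)"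
  | "sat \<tau> M (Conj J \<psi>) s = (\<forall>j\<in>J. sat \<tau> M (\<psi> j) s)"
  | "sat \<tau> M (Exists V \<phi>) s =
        (\<exists>s'. (\<forall>i. i \<notin> V \<longrightarrow> s' i = s i) \<and> (\<forall>i\<in>V. s' i \<in> universe M) \<and> sat \<tau> M \<phi> s')"

text \<open>\<open>\<phi>(M)\<close> for a formula with variables \<open>x\<^sub>i\<close>, \<open>i < \<eta>\<close>\<close>

definition solutions :: "('o::wellorder, 'f, 'p) vocab \<Rightarrow> ('o, 'f, 'p, 'm) struct \<Rightarrow> 'o \<Rightarrow>
    ('o, 'f, 'p, 'i) fm \<Rightarrow> ('o \<Rightarrow> 'm) set"
  where "solutions \<tau> M \<eta> \<phi> = {b \<in> seqs \<eta> (universe M). sat \<tau> M \<phi> b}"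

inductive_set terms :: "('o::wellorder, 'f, 'p) vocab \<Rightarrow> 'o \<Rightarrow> ('o, 'f) trm set"
  for \<tau> :: "('o, 'f, 'p) vocab" and \<epsilon> :: 'o
  where
    Var: "i < \<epsilon> \<Longrightarrow> Var i \<in> terms \<tau> \<epsilon>"
  | Zero: "Zero \<in> terms \<tau> \<epsilon>"
  | Plus: "t \<in> terms \<tau> \<epsilon> \<Longrightarrow> u \<in> terms \<tau> \<epsilon> \<Longrightarrow> Plus t u \<in> terms \<tau> \<epsilon>"
  | Minus: "t \<in> terms \<tau> \<epsilon> \<Longrightarrow> u \<in> terms \<tau> \<epsilon> \<Longrightarrow> Minus t u \<in> terms \<tau> \<epsilon>"
  | Fn: "F \<in> funs \<tau> \<Longrightarrow> \<forall>i<fun_arity \<tau> F. ts i \<in> terms \<tau> \<epsilon> \<Longrightarrow>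
      ts \<in> extensional {..<fun_arity \<tau> F} \<Longrightarrow> Fn F ts \<in> terms \<tau> \<epsilon>"

text \<open>\<open>\<Lambda>\<^bsup>pe\<^esup>\<^bsub>0,\<epsilon>\<^esub>\<close> for a general vocabulary\<close>

definition atomic_fms :: "('o::wellorder, 'f, 'p) vocab \<Rightarrow> 'o \<Rightarrow> ('o, 'f, 'p, 'i) fm set"
  where "atomic_fms \<tau> \<epsilon> =
    {Eq t u |t u. t \<in> terms \<tau> \<epsilon> \<and> u \<in> terms \<tau> \<epsilon>} \<union>
    {Rel P ts |P ts. P \<in> preds \<tau> \<and> ts \<in> seqs (pred_arity \<tau> P) (terms \<tau> \<epsilon>)}"

text \<open>
  \<open>\<Lambda>\<^bsup>pe\<^esup>\<^bsub>0,\<epsilon>\<^esub>\<close> for modules.  The sum \<open>\<Sum>\<^bsub>\<zeta><\<epsilon>\<^esub> a\<^sub>\<zeta> x\<^sub>\<zeta>\<close> is the term adding up the finitely many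
  \<open>F\<^bsub>a\<^sub>\<zeta>\<^esub>(x\<^sub>\<zeta>)\<close> with nonzero coefficient, in increasing order of \<open>\<zeta>\<close>.
\<close>

definition linear_trm :: "'f ring \<Rightarrow> 'o::wellorder \<Rightarrow> ('o \<Rightarrow> 'f) \<Rightarrow> ('o, 'f) trm"
  where "linear_trm R \<epsilon> a =
    foldr (\<lambda>\<zeta> t. Plus (Fn (a \<zeta>) (\<lambda>_\<in>{..<oone}. Var \<zeta>)) t)
      (sorted_list_of_set {\<zeta>. \<zeta> < \<epsilon> \<and> a \<zeta> \<noteq> \<zero>\<^bsub>R\<^esub>}) Zero"

definition linear_fms :: "'f ring \<Rightarrow> 'o::wellorder \<Rightarrow> ('o, 'f, 'p, 'i) fm set"
  where "linear_fms R \<epsilon> =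
    {Eq (linear_trm R \<epsilon> a) Zero |a.
       a \<in> seqs \<epsilon> (carrier R) \<and> finite {\<zeta>. \<zeta> < \<epsilon> \<and> a \<zeta> \<noteq> \<zero>\<^bsub>R\<^esub>}}"

text \<open>
  \<open>pe \<theta> B \<alpha> \<epsilon> \<phi>\<close>: \<open>\<phi>\<close> belongs to \<open>\<Lambda>\<^bsup>pe\<^esup>\<^bsub>\<alpha>,\<epsilon>\<^esub>\<close>, where \<open>B \<epsilon>\<close> is \<open>\<Lambda>\<^bsup>pe\<^esup>\<^bsub>0,\<epsilon>\<^esub>\<close>.  In \<open>\<phi>(x, y)\<close> with
  \<open>lh(x) = \<epsilon>\<close> and \<open>lh(y) = \<zeta>\<close>, the sequence \<open>y\<close> consists of the variables indexed by
  \<open>{\<epsilon>..<\<epsilon> + \<zeta>}\<close>.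
\<close>

inductive pe :: "'o::wellorder \<Rightarrow> ('o \<Rightarrow> ('o, 'f, 'p, 'i) fm set) \<Rightarrow>
    'o \<Rightarrow> 'o \<Rightarrow> ('o, 'f, 'p, 'i) fm \<Rightarrow> bool"
  for \<theta> :: 'o and B :: "'o \<Rightarrow> ('o, 'f, 'p, 'i) fm set"
  where
    zero: "\<epsilon> < \<theta> \<Longrightarrow> \<phi> \<in> B \<epsilon> \<Longrightarrow> pe \<theta> B ozero \<epsilon> \<phi>"
  | limit: "is_limit \<alpha> \<Longrightarrow> \<beta> < \<alpha> \<Longrightarrow> pe \<theta> B \<beta> \<epsilon> \<phi> \<Longrightarrow> pe \<theta> B \<alpha> \<epsilon> \<phi>"
  | succ: "is_succ \<beta> \<alpha> \<Longrightarrow> pe \<theta> B \<beta> \<epsilon> \<phi> \<Longrightarrow> pe \<theta> B \<alpha> \<epsilon> \<phi>"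
  | succ_ex: "is_succ \<beta> \<alpha> \<Longrightarrow> \<epsilon> < \<theta> \<Longrightarrow> \<zeta> < \<theta> \<Longrightarrow>
      \<forall>j\<in>J. pe \<theta> B \<beta> (oadd \<epsilon> \<zeta>) (\<psi> j) \<Longrightarrow>
      pe \<theta> B \<alpha> \<epsilon> (Exists {\<epsilon>..<oadd \<epsilon> \<zeta>} (Conj J \<psi>))"

definition pe_fms :: "'o::wellorder \<Rightarrow> ('o \<Rightarrow> ('o, 'f, 'p, 'i) fm set) \<Rightarrow> 'o \<Rightarrow> 'o \<Rightarrow>
    ('o, 'f, 'p, 'i) fm set"
  where "pe_fms \<theta> B \<alpha> \<epsilon> = {\<phi>. pe \<theta> B \<alpha> \<epsilon> \<phi>}"


section \<open>Convergence\<close>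

definition seq_diff :: "('o::wellorder, 'f, 'p, 'm) struct \<Rightarrow> 'o \<Rightarrow>
    ('o \<Rightarrow> 'm) \<Rightarrow> ('o \<Rightarrow> 'm) \<Rightarrow> 'o \<Rightarrow> 'm"
  where "seq_diff M \<eta> a c = (\<lambda>i\<in>{..<\<eta>}. minus_int M (a i) (c i))"

text \<open>\<open>(\<chi>, \<Phi>)\<close>-convergence of a set of sequences of length \<open>\<epsilon>\<close>; \<open>v\<close> is the constant truth value.\<close>

definition phi_convergent :: "'o::wellorder \<Rightarrow> ('o, 'f, 'p) vocab \<Rightarrow>
    ('o \<Rightarrow> ('o, 'f, 'p, 'i) fm set) \<Rightarrow> 'o \<Rightarrow> ('o, 'f, 'p, 'm) struct \<Rightarrow> 'o \<Rightarrow>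
    'x rel \<Rightarrow> ('o, 'f, 'p, 'i) fm set \<Rightarrow> ('o \<Rightarrow> 'm) set \<Rightarrow> bool"
  where "phi_convergent \<theta> \<tau> B \<gamma> M \<epsilon> \<chi> \<Phi> I \<longleftrightarrow>
    I \<subseteq> seqs \<epsilon> (universe M) \<and> \<chi> \<le>o |I| \<and>
    (\<forall>\<xi><\<theta>. \<forall>\<phi> \<in> \<Phi> \<inter> pe_fms \<theta> B \<gamma> (oadd \<epsilon> \<xi>).
       \<forall>b \<in> seqs \<xi> (universe M). \<forall>c \<in> seqs (oadd \<epsilon> \<xi>) (universe M).
         \<exists>v. |{a \<in> I. (seq_diff M (oadd \<epsilon> \<xi>) (seq_append \<epsilon> \<xi> a b) c
                        \<in> solutions \<tau> M (oadd \<epsilon> \<xi>) \<phi>) \<noteq> v}| <o \<chi>)"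

end

(*
  Positive existential formulas define subgroups of powers of M.  Hence, for fixed phi, b and c, the
  sequences x with x^b - c in phi(M) form either the empty set or a coset of the subgroup of those y
  with y^0 in phi(M), and only the subgroups matter.  Up to equivalence there are at most kappa
  formulas, so at most kappa subgroups H arise.  Map i < lam to the function sending H to the least
  j < i such that a_j and a_i are congruent modulo H, or to None if there is no such j.  This is
  regressive at each H, so a Fodor argument at points of cofinality kappa^+, together with
  |i|^kappa < lam, makes the function constant on a stationary set S.  On S, for each H, either all
  a_i are congruent modulo H or no two are; so every coset contains all of them or at most one.
*)

theory Submission
  imports Defs
begin

text \<open>The pressing-down lemma treats one regressive value for each i, whereas here there is
  one value for every subgroup. At a point \<delta> of cofinality above \<kappa> these at most
  \<kappa> values are all below a single j < \<delta>, and since |j|^\<kappa> < lam there are fewer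
  than lam functions bounded by a given j. So the clubs that refute the possible constant functions
  can be met one level j at a time, and regularity of lam bounds each level. The count of subgroups
  is made in M itself: solution sets are counted, not formulas, since the number of formulas depends
  on the index type of conjunctions. One level of quantification costs one exponential; the base
  case and the use of \<theta>^- in place of \<theta> together cost two. As \<gamma> is a limit,
  beth at \<gamma> absorbs any finite number of exponentials. Modules are reduced to the general
  case: linear equations are atomic formulas, and convergence for more formulas implies convergence
  for fewer.\<close>

section \<open>Stationary sets\<close>

lemma Field_ord_rel [simp]: "Field (ord_rel \<alpha>) = {..<\<alpha>}"
  by (fastforce simp: ord_rel_def Field_def)

lemma in_ord_rel: "(x, y) \<in> ord_rel \<alpha> \<longleftrightarrow> x \<le> y \<and> y < \<alpha>"
  by (simp add: ord_rel_def)

lemma underS_ord_rel: "i < \<alpha> \<Longrightarrow> underS (ord_rel \<alpha>) i = {..<i}"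
  by (fastforce simp: ord_rel_def underS_def)

lemma Restr_ord_rel: "i \<le> \<alpha> \<Longrightarrow> Restr (ord_rel \<alpha>) {..<i} = ord_rel i"
  by (fastforce simp: ord_rel_def)

lemma cardinal_card_of: "cardinal \<kappa> \<Longrightarrow> |{..<\<kappa>}| =o ord_rel \<kappa>"
  using card_of_Field_ordIso[of "ord_rel \<kappa>"] by (simp add: cardinal_def)

lemma card_of_initial_less: "cardinal \<kappa> \<Longrightarrow> i < \<kappa> \<Longrightarrow> |{..<i}| <o ord_rel \<kappa>"
  using card_of_underS[of "ord_rel \<kappa>" i] by (simp add: cardinal_def underS_ord_rel)

lemma cardinal_less: "cardinal \<sigma> \<Longrightarrow> cardinal \<kappa> \<Longrightarrow> \<sigma> < \<kappa> \<Longrightarrow> ord_rel \<sigma> <o ord_rel \<kappa>"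
  using ordIso_ordLess_trans[OF ordIso_symmetric[OF cardinal_card_of] card_of_initial_less] by blast

lemma cardinal_le_iff:
  assumes "cardinal \<sigma>" "cardinal \<kappa>"
  shows "ord_rel \<sigma> \<le>o ord_rel \<kappa> \<longleftrightarrow> \<sigma> \<le> \<kappa>"
proof
  show "ord_rel \<sigma> \<le>o ord_rel \<kappa> \<Longrightarrow> \<sigma> \<le> \<kappa>"
    using cardinal_less[OF assms(2,1)] not_ordLess_ordLeq by (metis not_le_imp_less)
  show "\<sigma> \<le> \<kappa> \<Longrightarrow> ord_rel \<sigma> \<le>o ord_rel \<kappa>"
    using cardinal_less[OF assms] ordLess_imp_ordLeq ordLeq_refl assms(1)
    by (metis cardinal_def le_less)
qed

text \<open>The power hypothesis of the theorem speaks of initial segments \<open>{..<i}\<close>;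
  this provides the \<open>i\<close> when it is to be applied to another set.\<close>

lemma ex_initial_card:
  assumes "cardinal \<kappa>" "|A| <o ord_rel \<kappa>"
  obtains i where "i < \<kappa>" "|{..<i}| =o |A|"
proof -
  have "Well_order (ord_rel \<kappa>)"
    using assms(1) by (simp add: cardinal_def card_order_on_well_order_on)
  then obtain i where i: "i < \<kappa>" "|A| =o Restr (ord_rel \<kappa>) (underS (ord_rel \<kappa>) i)"
    using assms(2) ordLess_iff_ordIso_Restr[OF _ card_of_Well_order, of "ord_rel \<kappa>" A] by auto
  then have "|A| =o ord_rel i"
    by (simp add: underS_ord_rel Restr_ord_rel)
  from card_of_cong[OF this] have "|{..<i}| =o |A|"
    by (simp add: Field_card_of ordIso_symmetric)
  with i show thesis using that by blast
qed

lemma cardinal_no_max: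
  assumes "cardinal \<kappa>" "infinite {..<\<kappa>}" "i < \<kappa>"
  shows "\<exists>j<\<kappa>. i < j"
  using infinite_Card_order_limit[of "ord_rel \<kappa>" i] assms
  by (auto simp: cardinal_def in_ord_rel dest: le_neq_trans)

lemma regular_bounded:
  assumes "regular_cardinal \<kappa>" "A \<subseteq> {..<\<kappa>}" "|A| <o ord_rel \<kappa>"
  shows "\<exists>b<\<kappa>. \<forall>x\<in>A. x < b"
proof -
  have "\<not> cofinal A (ord_rel \<kappa>)"
  proof
    assume "cofinal A (ord_rel \<kappa>)"
    then have "|A| =o ord_rel \<kappa>"
      using assms(1,2) by (simp add: regular_cardinal_def regularCard_def)
    then show False using assms(3) not_ordLess_ordIso by blast
  qed
  then obtain c where c: "c < \<kappa>" "\<And>x. x \<in> A \<Longrightarrow> c = x \<or> (c, x) \<notin> ord_rel \<kappa>"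
    unfolding cofinal_def by auto
  \<comment> \<open>Failure of cofinality still allows \<open>c\<close> itself in \<open>A\<close>;
    a larger \<open>b\<close> makes the bound strict.\<close>
  obtain b where b: "b < \<kappa>" "c < b"
    using cardinal_no_max c assms(1) unfolding regular_cardinal_def by blast
  have "x < b" if "x \<in> A" for x
    using c(2)[OF that] b(2) that assms(2) by (force simp: in_ord_rel)
  then show ?thesis using b by blast
qed

lemma Cinfinite_ord_rel: "cardinal \<kappa> \<Longrightarrow> infinite {..<\<kappa>} \<Longrightarrow> Cinfinite (ord_rel \<kappa>)"
  by (simp add: cardinal_def cinfinite_def)

section \<open>Zero, successors and limits\<close>

lemma ozero_least: "ozero \<le> \<alpha>"
  unfolding ozero_def by (simp add: Least_le)

lemma not_less_ozero: "\<not> \<alpha> < ozero"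
  by (simp add: ozero_least leD)

lemma lessThan_ozero [simp]: "{..<ozero} = {}"
  by (auto simp: not_less_ozero)

lemma is_limitE:
  assumes "is_limit \<alpha>" "\<beta> < \<alpha>"
  obtains \<delta> where "is_succ \<beta> \<delta>" "\<delta> < \<alpha>"
proof -
  define \<delta> where "\<delta> = (LEAST \<delta>. \<beta> < \<delta>)"
  obtain \<delta>' where "\<beta> < \<delta>'" "\<delta>' < \<alpha>"
    using assms unfolding is_limit_def by blast
  then have "\<beta> < \<delta>" "\<delta> \<le> \<delta>'" "\<And>x. \<beta> < x \<Longrightarrow> \<delta> \<le> x"
    unfolding \<delta>_def by (auto intro: LeastI Least_le)
  then show thesis
    using that[of \<delta>] \<open>\<delta>' < \<alpha>\<close> by (auto simp: is_succ_def)
qed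

lemma is_limit_cardinal:
  assumes "cardinal \<kappa>" "infinite {..<\<kappa>}"
  shows "is_limit \<kappa>"
proof -
  have "\<kappa> \<noteq> ozero"
    using assms(2) by auto
  then show ?thesis
    using cardinal_no_max[OF assms] by (auto simp: is_limit_def)
qed

text \<open>The index sequence of the Fodor argument: every value lies beyond \<open>N\<close> of
  all earlier ones. It is defined for all \<open>\<xi>\<close>, but \<open>LEAST\<close> has a
  meaning only while a bound exists; \<open>stationary_constant\<close> shows this below
  \<open>p\<close>. \<open>N\<close> is an argument because it is chosen only inside that
  proof.\<close>

function climb :: "('o \<Rightarrow> 'o) \<Rightarrow> 'o::wellorder \<Rightarrow> 'o"
  where "climb N \<xi> = (LEAST b. \<forall>\<zeta>\<in>{..<\<xi>}. N (climb N \<zeta>) < b)"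
  by pat_completeness auto
termination by (relation "{((N, \<zeta>), (N', \<xi>)) |N N' \<zeta> \<xi>. \<zeta> < \<xi>}")
  (auto intro: wf_subset[OF wf_inv_image[OF wf, of snd]] simp: inv_image_def)

declare climb.simps [simp del]

text \<open>The least ordinal of cardinality above \<open>\<kappa>\<close> is \<open>\<kappa>\<^sup>+\<close>, and \<open>\<kappa>\<^sup>+\<close> is regular.\<close>

lemma ex_successor_length:
  fixes \<kappa> lam :: "'o::wellorder"
  assumes lam: "cardinal lam" and \<kappa>: "cardinal \<kappa>" "infinite {..<\<kappa>}"
    and less: "ctwo ^c ord_rel \<kappa> <o ord_rel lam"
  obtains p where "p < lam" and "p \<noteq> ozero"
    and "\<And>A. A \<subseteq> {..<p} \<Longrightarrow> |A| \<le>o ord_rel \<kappa> \<Longrightarrow> \<exists>b<p. \<forall>x\<in>A. x < b"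
proof -
  have co\<kappa>: "Card_order (ord_rel \<kappa>)" using \<kappa>(1) by (simp add: cardinal_def)
  have inf: "\<not> finite (Field (ord_rel \<kappa>))" using \<kappa>(2) by simp
  have "ctwo ^c ord_rel \<kappa> =o |Field (ctwo ^c ord_rel \<kappa>)|"
    by (rule ordIso_symmetric[OF card_of_Field_ordIso[OF Card_order_cexp]])
  note iso = this
  obtain i where i: "i < lam" "|{..<i}| =o |Field (ctwo ^c ord_rel \<kappa>)|"
    using ex_initial_card[OF lam ordIso_ordLess_trans[OF ordIso_symmetric[OF iso] less]] .
  \<comment> \<open>The cardinal 2^\<kappa> is above \<kappa> and is realized by some
    \<open>i\<close> below \<open>lam\<close>; hence the least ordinal \<open>p\<close> of size
    above \<kappa> exists in the type and lies below \<open>lam\<close>.\<close>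
  have "ord_rel \<kappa> <o |{..<i}|"
    by (rule ordLess_ordIso_trans[OF ordLess_ctwo_cexp[OF co\<kappa>]
          ordIso_transitive[OF iso ordIso_symmetric[OF i(2)]]])
  define p where "p = (LEAST p::'o. ord_rel \<kappa> <o |{..<p}| )"
  have p: "ord_rel \<kappa> <o |{..<p}|" "p \<le> i"
    unfolding p_def by (rule LeastI Least_le, fact)+
  have small: "|{..<b}| \<le>o ord_rel \<kappa>" if "b < p" for b
    using not_less_Least[OF that[unfolded p_def]] co\<kappa>
      ordLess_or_ordLeq[OF card_order_on_well_order_on card_of_Well_order] by blast
  have small': "|{..b}| \<le>o ord_rel \<kappa>" if "b < p" for b
  proof -
    have "{..b} = {..<b} \<union> {b}" by auto
    moreover have "|{b}| \<le>o ord_rel \<kappa>"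
      using inf by (intro Card_order_singl_ordLeq[OF co\<kappa>]) auto
    ultimately show ?thesis
      using card_of_Un_ordLeq_infinite_Field[OF inf small[OF that] _ co\<kappa>] by metis
  qed
  have bdd: "\<exists>b<p. \<forall>x\<in>A. x < b" if "A \<subseteq> {..<p}" "|A| \<le>o ord_rel \<kappa>" for A
  proof (rule ccontr)
    assume "\<not> ?thesis"
    then have "{..<p} \<subseteq> (\<Union>x\<in>A. {..x})"
      by (force simp: not_less)
    then have "|{..<p}| \<le>o |\<Union>x\<in>A. {..x}|" by (rule card_of_mono1)
    also have "|\<Union>x\<in>A. {..x}| \<le>o ord_rel \<kappa>"
      using that small' by (intro card_of_UNION_ordLeq_infinite_Field[OF inf co\<kappa>]) auto
    finally show False using p(1) not_ordLess_ordLeq by blast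
  qed
  have "p \<noteq> ozero"
  proof
    assume "p = ozero"
    then have "finite {..<p}" by simp
    then show False
      using p(1) inf by (metis card_of_ordLeq_finite Field_card_of card_of_Field_ordIso co\<kappa>
          ordIso_ordLeq_trans ordLess_imp_ordLeq)
  qed
  then show thesis using that[of p] bdd p(2) i(1) by auto
qed

lemma is_limitI:
  assumes "\<forall>j<\<delta>. \<exists>k<\<delta>. j < k" "i < \<delta>"
  shows "is_limit \<delta>"
  using assms not_less_ozero by (auto simp: is_limit_def)

text \<open>
  Suppose each candidate \<open>f\<close> had a club \<open>C f\<close> missing its fibre.  The supremum \<open>\<delta>\<close> of a suitable
  increasing sequence of length \<open>\<kappa>\<^sup>+\<close> lies in \<open>C f\<close> for every \<open>f\<close> bounded below \<open>\<delta>\<close>; since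
  \<open>|X| \<le> \<kappa> < cf(\<delta>)\<close>, the function \<open>F \<delta>\<close> is one of these.
\<close>

lemma stationary_constant:
  fixes lam \<kappa> :: "'o::wellorder" and F :: "'o \<Rightarrow> 'h \<Rightarrow> 'o option"
  assumes lam: "regular_cardinal lam" and \<kappa>: "cardinal \<kappa>" "infinite {..<\<kappa>}"
    and pow: "\<forall>i<lam. |{..<i}| ^c ord_rel \<kappa> <o ord_rel lam"
    and X: "|X| \<le>o ord_rel \<kappa>"
    and regr: "\<And>i x j. i < lam \<Longrightarrow> x \<in> X \<Longrightarrow> F i x = Some j \<Longrightarrow> j < i"
  shows "\<exists>S. stationary lam S \<and> (\<forall>i\<in>S. \<forall>j\<in>S. \<forall>x\<in>X. F i x = F j x)"
proof (rule ccontr)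
  assume neg: "\<not> ?thesis"
  define Sf where "Sf f = {i. i < lam \<and> (\<forall>x\<in>X. F i x = f x)}" for f
  have "\<exists>C. club lam C \<and> Sf f \<inter> C = {}" for f
  proof -
    have "\<not> stationary lam (Sf f)"
      using neg by (auto simp: Sf_def)
    then show ?thesis by (auto simp: stationary_def Sf_def)
  qed
  then obtain C where C: "\<And>f. club lam (C f)" "\<And>f. Sf f \<inter> C f = {}"
    by metis
  have cl: "cardinal lam" and il: "infinite {..<lam}"
    using lam by (auto simp: regular_cardinal_def)
  have co\<kappa>: "Card_order (ord_rel \<kappa>)" using \<kappa>(1) by (simp add: cardinal_def)
  have nomax: "\<exists>j<lam. i < j" if "i < lam" for i
    using cardinal_no_max[OF cl il that] .
  have finite_less_lam: "|A| <o ord_rel lam" if "finite A" for A :: "'z set"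
    using finite_ordLess_infinite[OF card_of_Well_order, of "ord_rel lam" A] cl il that
    by (simp add: Field_card_of cardinal_def card_order_on_well_order_on)
  \<comment> \<open>\<open>Func X (B j)\<close> consists of the functions on \<open>X\<close> whose
    ordinal values are below \<open>j\<close>; \<open>None\<close> is allowed at every
    level.\<close>
  define B where "B j = insert None (Some ` {..<j})" for j :: 'o
  have mono: "j \<le> k \<Longrightarrow> Func X (B j) \<subseteq> Func X (B k)" for j k
    by (force simp: Func_def B_def)
  have cardB: "|Func X (B j)| <o ord_rel lam" if j: "j < lam" for j
  proof -
    obtain k where k: "k < lam" "j < k" using nomax[OF j] by blast
    \<comment> \<open>\<open>B j\<close> has one element more than \<open>{..<j}\<close>. With
      \<open>j\<close> standing for \<open>None\<close> it is covered by the segment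
      \<open>{..<k}\<close>, to which \<open>pow\<close> applies.\<close>
    have "B j \<subseteq> (\<lambda>i. if i = j then None else Some i) ` {..<k}"
      using k by (auto simp: B_def image_iff)
    then have le: "|B j| \<le>o |{..<k}|" by (rule surj_imp_ordLeq)
    show ?thesis
    \<comment> \<open>\<open>cexp_mono'\<close> excludes an empty exponent below a nonempty one,
      since x^0 = 1 while 0^\<kappa> = 0.\<close>
    proof (cases "X = {}")
      case True
      then have "finite (Func X (B j))"
        using Func_empty by (metis finite.simps)
      then show ?thesis
        by (rule finite_less_lam)
    next
      case False
      have "|Func X (B j)| = |B j| ^c |X|"
        by (simp add: cexp_def Field_card_of)
      also have "|B j| ^c |X| \<le>o |{..<k}| ^c ord_rel \<kappa>"
        using False by (intro cexp_mono'[OF le X]) (simp add: Field_card_of)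
      finally show ?thesis
        using pow k(1) ordLeq_ordLess_trans by blast
    qed
  qed
  \<comment> \<open>The choice of \<open>N\<close>: between \<open>j\<close> and \<open>N j\<close>
    there is a point of \<open>C f\<close> for every \<open>f\<close> bounded by \<open>j\<close>.
    By \<open>cardB\<close> there are fewer than \<open>lam\<close> such \<open>f\<close>, so
    regularity bounds the points chosen.\<close>
  have "\<exists>k<lam. j < k \<and> (\<forall>f\<in>Func X (B j). \<exists>c\<in>C f. j < c \<and> c < k)" if j: "j < lam" for j
  proof -
    have "\<exists>c\<in>C f. j < c" for f using C(1)[of f] j by (auto simp: club_def)
    then obtain c where c: "\<And>f. c f \<in> C f \<and> j < c f" by metis
    have sub: "c ` Func X (B j) \<subseteq> {..<lam}" using c C(1) unfolding club_def by blast
    obtain b where b: "b < lam" "\<And>f. f \<in> Func X (B j) \<Longrightarrow> c f < b"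
      using regular_bounded[OF lam sub ordLeq_ordLess_trans[OF card_of_image cardB[OF j]]] by auto
    obtain k where k: "k < lam" "j < k" using nomax[OF j] by blast
    have "\<exists>c\<in>C f. j < c \<and> c < max b k" if "f \<in> Func X (B j)" for f
      using c[of f] b(2)[OF that] by (auto simp: less_max_iff_disj)
    then show ?thesis using b k by (intro exI[of _ "max b k"]) (auto simp: less_max_iff_disj)
  qed
  then obtain N where N: "\<And>j. j < lam \<Longrightarrow> N j < lam \<and> j < N j"
    "\<And>j f. j < lam \<Longrightarrow> f \<in> Func X (B j) \<Longrightarrow> \<exists>c\<in>C f. j < c \<and> c < N j"
    by metis
  have "ctwo ^c ord_rel \<kappa> <o ord_rel lam"
  proof -
    \<comment> \<open>\<open>pow\<close> is applied at the ordinal of cardinality 2.\<close>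
    have "|UNIV :: bool set| <o ord_rel lam"
      by (intro finite_less_lam) simp
    then obtain i where i: "i < lam" "|{..<i}| =o |UNIV :: bool set|"
      using ex_initial_card[OF cl] by blast
    have "ctwo ^c ord_rel \<kappa> =o |{..<i}| ^c ord_rel \<kappa>"
      unfolding ctwo_def using cexp_cong1[OF ordIso_symmetric[OF i(2)] co\<kappa>] .
    then show ?thesis using pow i(1) ordIso_ordLess_trans by blast
  qed
  then obtain p where p: "p < lam" "p \<noteq> ozero"
    and pbdd: "\<And>A. A \<subseteq> {..<p} \<Longrightarrow> |A| \<le>o ord_rel \<kappa> \<Longrightarrow> \<exists>b<p. \<forall>x\<in>A. x < b"
    using ex_successor_length[OF cl \<kappa>] by blast
  have pnomax: "\<exists>k<p. i < k" if "i < p" for i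
  proof -
    have "|{i}| \<le>o ord_rel \<kappa>"
      using \<kappa>(2) co\<kappa> by (metis Card_order_singl_ordLeq Field_ord_rel finite.emptyI)
    then show ?thesis using pbdd[of "{i}"] that by auto
  qed
  define g where "g = climb N"
  have sup: "\<exists>b<lam. \<forall>\<zeta><\<xi>. G \<zeta> < b" if "\<xi> \<le> p" "\<And>\<zeta>. \<zeta> < \<xi> \<Longrightarrow> G \<zeta> < lam" for \<xi> G
  proof -
    have "|G ` {..<\<xi>}| \<le>o |{..<\<xi>}|" by (rule card_of_image)
    also have "|{..<\<xi>}| <o ord_rel lam"
      using card_of_initial_less[OF cl] that(1) p(1) by simp
    finally show ?thesis
      using regular_bounded[OF lam, of "G ` {..<\<xi>}"] that(2) by auto
  qed
  have g: "g \<xi> < lam \<and> (\<forall>\<zeta><\<xi>. N (g \<zeta>) < g \<xi>)" if "\<xi> < p" for \<xi>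
    using that
  proof (induction \<xi> rule: less_induct)
    case (less \<xi>)
    have "\<exists>b<lam. \<forall>\<zeta><\<xi>. N (g \<zeta>) < b"
      using less N(1) by (intro sup) auto
    then obtain b where b: "b < lam" "\<forall>\<zeta>\<in>{..<\<xi>}. N (g \<zeta>) < b" by auto
    have eq: "g \<xi> = (LEAST b. \<forall>\<zeta>\<in>{..<\<xi>}. N (g \<zeta>) < b)"
      unfolding g_def by (rule climb.simps)
    have "\<forall>\<zeta>\<in>{..<\<xi>}. N (g \<zeta>) < g \<xi>"
      unfolding eq by (rule LeastI[of _ b]) (rule b(2))
    moreover have "g \<xi> \<le> b"
      unfolding eq by (rule Least_le) (rule b(2))
    ultimately show ?case using b(1) by auto
  qed
  obtain b where b: "b < lam" "\<forall>\<zeta><p. g \<zeta> < b" using sup[of p g] g by auto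
  define \<delta> where "\<delta> = (LEAST b. \<forall>\<zeta><p. g \<zeta> < b)"
  have \<delta>: "\<And>\<zeta>. \<zeta> < p \<Longrightarrow> g \<zeta> < \<delta>" "\<delta> \<le> b"
    unfolding \<delta>_def using LeastI[of "\<lambda>b. \<forall>\<zeta><p. g \<zeta> < b"] b(2) Least_le[of "\<lambda>b. \<forall>\<zeta><p. g \<zeta> < b"]
    by blast+
  have \<delta>lam: "\<delta> < lam" using \<delta>(2) b(1) by simp
  have cof: "\<exists>\<xi><p. i < g \<xi>" if i: "i < \<delta>" for i
  proof -
    obtain \<xi> where \<xi>: "\<xi> < p" "i \<le> g \<xi>"
      using not_less_Least[OF i[unfolded \<delta>_def]] by (auto simp: not_less)
    obtain \<xi>' where "\<xi>' < p" "\<xi> < \<xi>'" using pnomax \<xi>(1) by blast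
    then have "g \<xi> < g \<xi>'" using g[of \<xi>'] g[of \<xi>] N(1)[of "g \<xi>"] \<xi>(1) by force
    then show ?thesis using \<xi> \<open>\<xi>' < p\<close> by (meson le_less_trans)
  qed
  have gmono: "g \<zeta> \<le> g \<xi>" if "\<zeta> \<le> \<xi>" "\<xi> < p" for \<zeta> \<xi>
  proof (cases "\<zeta> = \<xi>")
    case False
    then have "g \<zeta> < N (g \<zeta>)" "N (g \<zeta>) < g \<xi>"
      using that g[of \<xi>] g[of \<zeta>] N(1)[of "g \<zeta>"] by auto
    then show ?thesis by simp
  qed simp
  \<comment> \<open>Since \<open>F\<close> is regressive, the ordinal values of this candidate lie
    below \<delta>, though not yet below a single \<open>g \<xi>\<close>. The value
    \<open>undefined\<close> outside \<open>X\<close> is the convention of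
    \<open>Func\<close>.\<close>
  define f where "f = (\<lambda>x. if x \<in> X then F \<delta> x else undefined)"
  have "\<exists>\<xi><p. \<forall>i. F \<delta> x = Some i \<longrightarrow> i < g \<xi>" if "x \<in> X" for x
  proof (cases "F \<delta> x")
    case None
    then show ?thesis using p(2) ozero_least[of p] by (auto simp: le_less)
  next
    case (Some i)
    then show ?thesis using cof[OF regr[OF \<delta>lam that Some]] by auto
  qed
  then obtain h where h: "\<And>x. x \<in> X \<Longrightarrow> h x < p" "\<And>x i. x \<in> X \<Longrightarrow> F \<delta> x = Some i \<Longrightarrow> i < g (h x)"
    by metis
  \<comment> \<open>Here cofinality above \<kappa> enters: the at most \<kappa> places
    \<open>h x\<close> have a common bound \<open>\<eta>\<close> below \<open>p\<close>, so
    \<open>f\<close> is bounded by \<open>g \<eta>\<close>.\<close>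
  have "|h ` X| \<le>o ord_rel \<kappa>" using card_of_image X ordLeq_transitive by blast
  then obtain \<eta> where \<eta>: "\<eta> < p" "\<And>x. x \<in> X \<Longrightarrow> h x < \<eta>"
    using pbdd[of "h ` X"] h(1) by auto
  have "i < g \<eta>" if "x \<in> X" "F \<delta> x = Some i" for x i
    using h(2)[OF that] gmono[OF less_imp_le[OF \<eta>(2)[OF that(1)]] \<eta>(1)] by simp
  then have "f \<in> Func X (B (g \<eta>))"
    unfolding f_def Func_def B_def by (auto, metis image_eqI lessThan_iff option.exhaust)
  then have fF: "f \<in> Func X (B (g \<xi>))" if "\<eta> \<le> \<xi>" "\<xi> < p" for \<xi>
    using mono gmono that by blast
  \<comment> \<open>From \<open>\<eta>\<close> on, \<open>f\<close> is among the functions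
    considered when \<open>N (g \<xi>)\<close> was chosen. So \<open>C f\<close> meets the interval
    from \<open>g \<xi>\<close> to \<open>N (g \<xi>)\<close>, which ends below the next value of
    \<open>g\<close>.\<close>
  have climbs: "\<exists>c\<in>C f. i < c \<and> c < \<delta>" if i: "i < \<delta>" for i
  proof -
    obtain \<xi>0 where \<xi>0: "\<xi>0 < p" "i < g \<xi>0" using cof[OF i] by blast
    define \<xi> where "\<xi> = max \<eta> \<xi>0"
    have \<xi>: "\<xi> < p" "\<eta> \<le> \<xi>" "\<xi>0 \<le> \<xi>" using \<xi>0 \<eta> by (auto simp: \<xi>_def)
    obtain \<xi>' where \<xi>': "\<xi>' < p" "\<xi> < \<xi>'" using pnomax \<xi>(1) by blast
    obtain c where c: "c \<in> C f" "g \<xi> < c" "c < N (g \<xi>)"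
      using N(2)[of "g \<xi>" f] g[of \<xi>] fF \<xi> by blast
    have "i < c" using \<xi>0(2) gmono[OF \<xi>(3,1)] c(2) by simp
    moreover have "c < \<delta>" using c(3) g[of \<xi>'] \<xi>' \<delta>(1)[of \<xi>'] by force
    ultimately show ?thesis using c(1) by blast
  qed
  have "g ozero < \<delta>" using \<delta>(1) p(2) ozero_least[of p] by (simp add: le_less)
  moreover have "\<forall>j<\<delta>. \<exists>k<\<delta>. j < k"
    using climbs by blast
  ultimately have "is_limit \<delta>" using is_limitI by blast
  then have "\<delta> \<in> C f" using C(1)[of f] \<delta>lam climbs by (auto simp: club_def)
  moreover have "\<delta> \<in> Sf f" using \<delta>lam by (simp add: Sf_def f_def)
  ultimately show False using C(2) by blast
qed

text \<open>\<open>F i x\<close> is the first element equivalent to \<open>i\<close> and smaller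
  than \<open>i\<close>. If it is constantly \<open>Some k\<close> on \<open>S\<close>, all members
  are equivalent to \<open>k\<close>, which may lie outside \<open>S\<close>; if it is
  \<open>None\<close>, each member is the first of its class, so no two are equivalent.\<close>

lemma stationary_homogeneous:
  fixes lam \<kappa> :: "'o::wellorder" and E :: "'h \<Rightarrow> 'o \<Rightarrow> 'o \<Rightarrow> bool"
  assumes "regular_cardinal lam" "cardinal \<kappa>" "infinite {..<\<kappa>}"
    and "\<forall>i<lam. |{..<i}| ^c ord_rel \<kappa> <o ord_rel lam"
    and "|X| \<le>o ord_rel \<kappa>"
    and refl: "\<And>x i. x \<in> X \<Longrightarrow> i < lam \<Longrightarrow> E x i i"
    and sym: "\<And>x i j. x \<in> X \<Longrightarrow> i < lam \<Longrightarrow> j < lam \<Longrightarrow> E x i j \<Longrightarrow> E x j i"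
    and trans: "\<And>x i j k. x \<in> X \<Longrightarrow> i < lam \<Longrightarrow> j < lam \<Longrightarrow> k < lam \<Longrightarrow> E x i j \<Longrightarrow> E x j k \<Longrightarrow> E x i k"
  shows "\<exists>S. stationary lam S \<and>
    (\<forall>x\<in>X. (\<forall>i\<in>S. \<forall>j\<in>S. E x i j) \<or> (\<forall>i\<in>S. \<forall>j\<in>S. i \<noteq> j \<longrightarrow> \<not> E x i j))"
proof -
  define F where "F i x = (if \<exists>j<i. E x j i then Some (LEAST j. j < i \<and> E x j i) else None)" for i x
  have F: "j < i \<and> E x j i" if "F i x = Some j" for i x j
    using that LeastI_ex[of "\<lambda>j. j < i \<and> E x j i"] by (auto simp: F_def split: if_splits)
  then obtain S where S: "stationary lam S" "\<And>i j x. i \<in> S \<Longrightarrow> j \<in> S \<Longrightarrow> x \<in> X \<Longrightarrow> F i x = F j x"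
    using stationary_constant[OF assms(1-5), of F] by metis
  have Slam: "i < lam" if "i \<in> S" for i using S(1) that by (auto simp: stationary_def)
  have "(\<forall>i\<in>S. \<forall>j\<in>S. E x i j) \<or> (\<forall>i\<in>S. \<forall>j\<in>S. i \<noteq> j \<longrightarrow> \<not> E x i j)" if x: "x \<in> X" for x
  proof (cases "\<exists>i\<in>S. F i x \<noteq> None")
    case True
    then obtain i0 k where i0: "i0 \<in> S" "F i0 x = Some k" by auto
    then have k: "F i x = Some k" if "i \<in> S" for i using S(2)[OF that i0(1) x] by simp
    have "E x i j" if "i \<in> S" "j \<in> S" for i j
    proof -
      have "k < i \<and> E x k i" "k < j \<and> E x k j" using F k that by blast+
      moreover from this have "k < lam" using Slam that by (meson less_trans)
      ultimately show ?thesis using sym trans x Slam that by blast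
    qed
    then show ?thesis by blast
  next
    case False
    then have none: "\<not> E x j i" if "i \<in> S" "j < i" for i j
      using that by (auto simp: F_def split: if_splits)
    have "\<not> E x i j" if "i \<in> S" "j \<in> S" "i \<noteq> j" for i j
      using none[of i j] none[of j i] that sym[OF x] Slam by (meson linorder_neqE)
    then show ?thesis by blast
  qed
  then show ?thesis using S(1) by blast
qed

text \<open>Final segments of \<open>lam\<close> are clubs, so \<open>S\<close> is unbounded, and
  regularity makes unbounded sets as large as \<open>lam\<close>.\<close>

lemma card_of_stationary:
  assumes lam: "regular_cardinal lam" and S: "stationary lam S"
  shows "|S| =o ord_rel lam"
proof -
  have "\<exists>j\<in>S. i < j" if "i < lam" for i
  proof -
    have "club lam {i<..<lam}"
      unfolding club_def
    proof (intro conjI allI impI)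
      fix k assume "k < lam"
      then have "max i k < lam" using that by simp
      then obtain j where "j < lam" "max i k < j"
        using cardinal_no_max lam unfolding regular_cardinal_def by blast
      then show "\<exists>j\<in>{i<..<lam}. k < j" by auto
    next
      fix \<delta> assume \<delta>: "\<delta> < lam" "is_limit \<delta> \<and> (\<forall>k<\<delta>. \<exists>j\<in>{i<..<lam}. k < j \<and> j < \<delta>)"
      \<comment> \<open>A limit \<delta> is nonzero, so the closure hypothesis can be used at 0 and
        yields an element of \<open>{i<..<lam}\<close> below \<delta>.\<close>
      then have "ozero < \<delta>" using ozero_least[of \<delta>] by (auto simp: is_limit_def le_less)
      then show "\<delta> \<in> {i<..<lam}" using \<delta> by force
    qed auto
    then show ?thesis using S by (fastforce simp: stationary_def)
  qed
  then have "cofinal S (ord_rel lam)"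
    unfolding cofinal_def Field_ord_rel in_ord_rel stationary_def Ball_def lessThan_iff
    using S unfolding stationary_def by (metis lessThan_iff less_imp_le less_irrefl subsetD)
  then show ?thesis
    using lam S by (simp add: regular_cardinal_def regularCard_def stationary_def)
qed

section \<open>Solution sets are subgroups\<close>

locale additive =
  fixes \<tau> :: "('o::wellorder, 'f, 'p) vocab" and M :: "('o, 'f, 'p, 'm) struct"
  assumes additive: "additive_struct \<tau> M"
begin

abbreviation "U \<equiv> universe M"
abbreviation minus_M (infixl "-\<^sub>M" 65) where "x -\<^sub>M y \<equiv> minus_int M x y"

sublocale G: comm_group "group_of M"
  rewrites "carrier (group_of M) = U"
    and "monoid.mult (group_of M) = plus_int M" and "one (group_of M) = zero_int M"
  using additive by (simp_all add: additive_struct_def group_of_def)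

lemma carrier_group_of: "carrier (group_of M) = U"
  and mult_group_of: "monoid.mult (group_of M) = plus_int M"
  by (simp_all add: group_of_def)

lemma minus_eq: "x \<in> U \<Longrightarrow> y \<in> U \<Longrightarrow> x -\<^sub>M y = plus_int M x (inv\<^bsub>group_of M\<^esub> y)"
  using additive by (simp add: additive_struct_def)

lemma minus_closed [simp]: "x \<in> U \<Longrightarrow> y \<in> U \<Longrightarrow> x -\<^sub>M y \<in> U"
  by (simp add: minus_eq)

lemma minus_self [simp]: "x \<in> U \<Longrightarrow> x -\<^sub>M x = zero_int M"
  by (simp add: minus_eq)

lemma minus_zero [simp]: "x \<in> U \<Longrightarrow> x -\<^sub>M zero_int M = x"
  by (simp add: minus_eq)

lemma inv_minus: "x \<in> U \<Longrightarrow> y \<in> U \<Longrightarrow> inv\<^bsub>group_of M\<^esub> (x -\<^sub>M y) = y -\<^sub>M x"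
  by (simp add: minus_eq G.inv_mult G.m_comm)

lemma zero_minus_minus: "x \<in> U \<Longrightarrow> y \<in> U \<Longrightarrow> zero_int M -\<^sub>M (x -\<^sub>M y) = y -\<^sub>M x"
  by (simp add: minus_eq[of _ "_ -\<^sub>M _"] inv_minus)

lemma plus_minus_plus:
  "x \<in> U \<Longrightarrow> y \<in> U \<Longrightarrow> x' \<in> U \<Longrightarrow> y' \<in> U \<Longrightarrow>
    plus_int M x y -\<^sub>M plus_int M x' y' = plus_int M (x -\<^sub>M x') (y -\<^sub>M y')"
  by (simp add: minus_eq G.inv_mult G.m_ac)

lemma minus_minus_minus:
  "x \<in> U \<Longrightarrow> y \<in> U \<Longrightarrow> x' \<in> U \<Longrightarrow> y' \<in> U \<Longrightarrow>
    (x -\<^sub>M y) -\<^sub>M (x' -\<^sub>M y') = (x -\<^sub>M x') -\<^sub>M (y -\<^sub>M y')"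
  by (simp add: minus_eq G.inv_mult G.m_ac)

lemma minus_cancel_right: "x \<in> U \<Longrightarrow> y \<in> U \<Longrightarrow> c \<in> U \<Longrightarrow> (x -\<^sub>M c) -\<^sub>M (y -\<^sub>M c) = x -\<^sub>M y"
  using minus_minus_minus[of x c y c] by simp

lemma minus_cancel_left: "x \<in> U \<Longrightarrow> y \<in> U \<Longrightarrow> c \<in> U \<Longrightarrow> (y -\<^sub>M c) -\<^sub>M (y -\<^sub>M x) = x -\<^sub>M c"
  using minus_minus_minus[of y c y x] by (simp add: zero_minus_minus)

lemma subgroup_power:
  assumes "subgroup H (product_group I (\<lambda>_. group_of M))"
  shows "H \<subseteq> I \<rightarrow>\<^sub>E U" and "(\<lambda>i\<in>I. zero_int M) \<in> H"
    and "x \<in> H \<Longrightarrow> y \<in> H \<Longrightarrow> (\<lambda>i\<in>I. x i -\<^sub>M y i) \<in> H"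
proof -
  show sub: "H \<subseteq> I \<rightarrow>\<^sub>E U"
    using subgroup.subset[OF assms] by (simp add: group_of_def)
  show "(\<lambda>i\<in>I. zero_int M) \<in> H"
    using subgroup.one_closed[OF assms] by (simp add: group_of_def)
  assume x: "x \<in> H" and y: "y \<in> H"
  let ?P = "product_group I (\<lambda>_. group_of M)"
  have "x \<otimes>\<^bsub>?P\<^esub> inv\<^bsub>?P\<^esub> y \<in> H"
    using assms x y by (simp only: subgroup.m_closed subgroup.m_inv_closed)
  moreover have "inv\<^bsub>?P\<^esub> y = (\<lambda>i\<in>I. inv\<^bsub>group_of M\<^esub> y i)"
    using y sub by (intro inv_product_group) (auto simp: carrier_group_of G.is_group)
  moreover have "x i \<in> U \<and> y i \<in> U" if "i \<in> I" for i
    using x y sub that by blast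
  then have "(\<lambda>i\<in>I. x i -\<^sub>M y i) = x \<otimes>\<^bsub>?P\<^esub> (\<lambda>i\<in>I. inv\<^bsub>group_of M\<^esub> y i)"
    by (auto simp: minus_eq PiE_mem mult_group_of fun_eq_iff)
  ultimately show "(\<lambda>i\<in>I. x i -\<^sub>M y i) \<in> H" by simp
qed

lemma pred_int_subgroup:
  "P \<in> preds \<tau> \<Longrightarrow> subgroup (pred_int M P) (product_group {..<pred_arity \<tau> P} (\<lambda>_. group_of M))"
  using additive by (simp add: additive_struct_def)

lemma fun_graph_subgroup:
  "F \<in> funs \<tau> \<Longrightarrow> subgroup (fun_graph (fun_arity \<tau> F) U (fun_int M F))
     (product_group {..fun_arity \<tau> F} (\<lambda>_. group_of M))"
  using additive by (simp add: additive_struct_def)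

lemma fun_int_closed:
  "F \<in> funs \<tau> \<Longrightarrow> fun_int M F s = Some y \<Longrightarrow> s \<in> seqs (fun_arity \<tau> F) U \<and> y \<in> U"
  using additive by (simp add: additive_struct_def)

text \<open>For a partial function, a subgroup as graph says more than additivity: the domain itself
  contains zero and is closed under differences. This keeps terms defined where the subgroup
  argument needs them.\<close>

lemma fun_int_zero:
  assumes F: "F \<in> funs \<tau>"
  shows "fun_int M F (\<lambda>i\<in>{..<fun_arity \<tau> F}. zero_int M) = Some (zero_int M)"
proof -
  have "restrict (\<lambda>i\<in>{..fun_arity \<tau> F}. zero_int M) {..<fun_arity \<tau> F}
      = (\<lambda>i\<in>{..<fun_arity \<tau> F}. zero_int M)"
    by (auto simp: restrict_def fun_eq_iff)
  then show ?thesis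
    using subgroup_power(2)[OF fun_graph_subgroup[OF F]] by (simp add: fun_graph_def)
qed

lemma fun_int_minus:
  assumes F: "F \<in> funs \<tau>" and "fun_int M F s = Some x" "fun_int M F s' = Some x'"
  shows "fun_int M F (\<lambda>i\<in>{..<fun_arity \<tau> F}. s i -\<^sub>M s' i) = Some (x -\<^sub>M x')"
proof -
  let ?n = "fun_arity \<tau> F"
  have graph: "s(?n := x) \<in> fun_graph ?n U (fun_int M F)" if "fun_int M F s = Some x" for s x
  proof -
    have s: "s \<in> {..<?n} \<rightarrow>\<^sub>E U" "x \<in> U"
      using fun_int_closed[OF F that] by (auto simp: seqs_def)
    then have "restrict (s(?n := x)) {..<?n} = s"
      by (auto simp: fun_eq_iff restrict_def PiE_arb[OF s(1)])
    moreover have "s(?n := x) \<in> {..?n} \<rightarrow>\<^sub>E U"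
      using s by (auto simp: PiE_iff extensional_def le_less)
    ultimately show ?thesis using that by (simp add: fun_graph_def)
  qed
  let ?d = "\<lambda>i\<in>{..?n}. (s(?n := x)) i -\<^sub>M (s'(?n := x')) i"
  have "?d \<in> fun_graph ?n U (fun_int M F)"
    using graph assms(2,3) subgroup_power(3)[OF fun_graph_subgroup[OF F]] by blast
  moreover have "restrict ?d {..<?n} = (\<lambda>i\<in>{..<?n}. s i -\<^sub>M s' i)"
    by (auto simp: restrict_def fun_eq_iff)
  ultimately show ?thesis by (simp add: fun_graph_def)
qed

lemma eval_zero:
  assumes "t \<in> terms \<tau> \<eta>" "\<And>i. i < \<eta> \<Longrightarrow> k i = zero_int M"
  shows "eval \<tau> M k t = Some (zero_int M)"
  using assms(1)
proof induction
  case (Fn F ts)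
  then have "(\<lambda>i\<in>{..<fun_arity \<tau> F}. the (eval \<tau> M k (ts i))) = (\<lambda>i\<in>{..<fun_arity \<tau> F}. zero_int M)"
    by (auto simp: restrict_def)
  then show ?case using Fn fun_int_zero[OF Fn.hyps(1)] by simp
next
  case (Var i)
  then show ?case using assms(2) by simp
qed simp_all

text \<open>A term is a partial homomorphism whose domain is closed under differences. Membership in
  \<open>U\<close> is carried through the induction because the group laws hold only there.\<close>

lemma eval_minus:
  assumes "t \<in> terms \<tau> \<eta>" "\<And>i. i < \<eta> \<Longrightarrow> s i \<in> U \<and> s' i \<in> U \<and> k i = s i -\<^sub>M s' i"
    and "eval \<tau> M s t = Some x" "eval \<tau> M s' t = Some x'"
  shows "x \<in> U \<and> x' \<in> U \<and> eval \<tau> M k t = Some (x -\<^sub>M x')"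
  using assms(1,3,4)
proof (induction arbitrary: x x')
  case (Plus t u)
  from Plus.prems obtain a b a' b' where
    "eval \<tau> M s t = Some a" "eval \<tau> M s u = Some b" "x = plus_int M a b"
    "eval \<tau> M s' t = Some a'" "eval \<tau> M s' u = Some b'" "x' = plus_int M a' b'"
    by (auto split: option.splits)
  then show ?case using Plus.IH by (auto simp: plus_minus_plus)
next
  case (Minus t u)
  from Minus.prems obtain a b a' b' where
    "eval \<tau> M s t = Some a" "eval \<tau> M s u = Some b" "x = a -\<^sub>M b"
    "eval \<tau> M s' t = Some a'" "eval \<tau> M s' u = Some b'" "x' = a' -\<^sub>M b'"
    by (auto split: option.splits)
  then show ?case using Minus.IH by (auto simp: minus_minus_minus)
next
  case (Fn F ts)
  let ?n = "fun_arity \<tau> F"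
  let ?A = "\<lambda>s. \<lambda>i\<in>{..<?n}. the (eval \<tau> M s (ts i))"
  have def: "eval \<tau> M s (ts i) \<noteq> None" "eval \<tau> M s' (ts i) \<noteq> None" if "i < ?n" for i
    using Fn.prems that by (auto split: if_splits)
  have x: "fun_int M F (?A s) = Some x" "fun_int M F (?A s') = Some x'"
    using Fn.prems by (auto split: if_splits)
  have k: "eval \<tau> M k (ts i) = Some (?A s i -\<^sub>M ?A s' i)" if "i < ?n" for i
    using Fn.IH def that by fastforce
  then have "?A k = (\<lambda>i\<in>{..<?n}. ?A s i -\<^sub>M ?A s' i)"
    by (auto simp: restrict_def)
  then have "eval \<tau> M k (Fn F ts) = Some (x -\<^sub>M x')"
    using fun_int_minus[OF Fn.hyps(1) x] k by auto
  then show ?case using fun_int_closed[OF Fn.hyps(1) x(1)] fun_int_closed[OF Fn.hyps(1) x(2)] by blast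
next
  case (Var i)
  then show ?case using assms(2)[OF Var.hyps] by simp
qed simp

text \<open>The subgroup property of the solution set, stated for assignments on the whole type
  instead of elements of \<open>seqs\<close>: under a quantifier, \<open>sat\<close> meets
  assignments with arbitrary values from \<open>\<eta>\<close> on. As \<open>k\<close> is
  unrestricted there, the property also contains locality of \<open>\<phi>\<close>.\<close>

definition diff_closed :: "'o \<Rightarrow> ('o, 'f, 'p, 'i) fm \<Rightarrow> bool"
  where "diff_closed \<eta> \<phi> \<longleftrightarrow>
    (\<forall>k. (\<forall>i<\<eta>. k i = zero_int M) \<longrightarrow> sat \<tau> M \<phi> k) \<and>
    (\<forall>s s' k. (\<forall>i<\<eta>. s i \<in> U \<and> s' i \<in> U \<and> k i = s i -\<^sub>M s' i) \<longrightarrow>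
       sat \<tau> M \<phi> s \<longrightarrow> sat \<tau> M \<phi> s' \<longrightarrow> sat \<tau> M \<phi> k)"

lemma diff_closed_zero: "diff_closed \<eta> \<phi> \<Longrightarrow> (\<And>i. i < \<eta> \<Longrightarrow> k i = zero_int M) \<Longrightarrow> sat \<tau> M \<phi> k"
  unfolding diff_closed_def by blast

lemma diff_closed_minus:
  "diff_closed \<eta> \<phi> \<Longrightarrow> (\<And>i. i < \<eta> \<Longrightarrow> s i \<in> U \<and> s' i \<in> U \<and> k i = s i -\<^sub>M s' i) \<Longrightarrow>
    sat \<tau> M \<phi> s \<Longrightarrow> sat \<tau> M \<phi> s' \<Longrightarrow> sat \<tau> M \<phi> k"
  unfolding diff_closed_def by blast

lemma diff_closed_atomic:
  assumes "\<phi> \<in> atomic_fms \<tau> \<eta>"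
  shows "diff_closed \<eta> \<phi>"
proof -
  consider t u where "\<phi> = Eq t u" "t \<in> terms \<tau> \<eta>" "u \<in> terms \<tau> \<eta>"
    | P ts where "\<phi> = Rel P ts" "P \<in> preds \<tau>" "ts \<in> seqs (pred_arity \<tau> P) (terms \<tau> \<eta>)"
    using assms by (auto simp: atomic_fms_def)
  then show ?thesis
  proof cases
    case 1
    have "sat \<tau> M \<phi> k" if k: "\<forall>i<\<eta>. s i \<in> U \<and> s' i \<in> U \<and> k i = s i -\<^sub>M s' i"
      and s: "sat \<tau> M \<phi> s" "sat \<tau> M \<phi> s'" for s s' k
    proof -
      obtain x x' where "eval \<tau> M s t = Some x" "eval \<tau> M s u = Some x"
        "eval \<tau> M s' t = Some x'" "eval \<tau> M s' u = Some x'"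
        using s 1(1) by (metis not_None_eq sat.simps(1))
      then show ?thesis
        using eval_minus[OF 1(2) k[rule_format], where x = x and x' = x'] eval_minus[OF 1(3) k[rule_format], where x = x and x' = x'] 1(1)
        by simp
    qed
    moreover have "sat \<tau> M \<phi> k" if k: "\<forall>i<\<eta>. k i = zero_int M" for k
      using 1 eval_zero[of _ \<eta> k] k by simp
    ultimately show ?thesis unfolding diff_closed_def by blast
  next
    case 2
    let ?n = "pred_arity \<tau> P"
    let ?A = "\<lambda>s. \<lambda>i\<in>{..<?n}. the (eval \<tau> M s (ts i))"
    have ts: "ts i \<in> terms \<tau> \<eta>" if "i < ?n" for i
      using 2(3) that by (auto simp: seqs_def)
    note sub = subgroup_power[OF pred_int_subgroup[OF 2(2)]]
    have "sat \<tau> M \<phi> k" if k: "\<forall>i<\<eta>. k i = zero_int M" for k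
    proof -
      have "eval \<tau> M k (ts i) = Some (zero_int M)" if "i < ?n" for i
        using eval_zero ts that k by blast
      moreover from this have "?A k = (\<lambda>i\<in>{..<?n}. zero_int M)" by (auto simp: restrict_def)
      ultimately show ?thesis using sub(2) 2(1) by simp
    qed
    moreover have "sat \<tau> M \<phi> k" if *: "\<forall>i<\<eta>. s i \<in> U \<and> s' i \<in> U \<and> k i = s i -\<^sub>M s' i"
      "sat \<tau> M \<phi> s" "sat \<tau> M \<phi> s'" for s s' k
    proof -
      have "eval \<tau> M k (ts i) = Some (?A s i -\<^sub>M ?A s' i)" if i: "i < ?n" for i
      proof -
        obtain x x' where "eval \<tau> M s (ts i) = Some x" "eval \<tau> M s' (ts i) = Some x'"
          using *(2,3) 2(1) i by fastforce
        then show ?thesis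
          using eval_minus[OF ts[OF i] *(1)[rule_format], where x = x and x' = x'] i by simp
      qed
      moreover from this have "?A k = (\<lambda>i\<in>{..<?n}. ?A s i -\<^sub>M ?A s' i)"
        by (auto simp: restrict_def)
      ultimately show ?thesis using sub(3)[of "?A s" "?A s'"] *(2,3) 2(1) by auto
    qed
    ultimately show ?thesis unfolding diff_closed_def by blast
  qed
qed

text \<open>Intersections and projections of subgroups are subgroups: the zero tuple is a witness at
  zero, and the difference of two witnesses is a witness for the difference.\<close>

lemma diff_closed_pe: "pe \<theta> (atomic_fms \<tau>) \<alpha> \<eta> \<phi> \<Longrightarrow> diff_closed \<eta> \<phi>"
proof (induction rule: pe.induct)
  case (succ_ex \<beta> \<alpha> \<epsilon> \<zeta> J \<psi>)
  let ?V = "{\<epsilon>..<oadd \<epsilon> \<zeta>}"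
  have zero: "sat \<tau> M (\<psi> j) k" if "j \<in> J" "\<forall>i< oadd \<epsilon> \<zeta>. k i = zero_int M" for j k
    using diff_closed_zero succ_ex that by blast
  have diff: "sat \<tau> M (\<psi> j) k" if "j \<in> J"
    "\<forall>i< oadd \<epsilon> \<zeta>. s i \<in> U \<and> s' i \<in> U \<and> k i = s i -\<^sub>M s' i"
    "sat \<tau> M (\<psi> j) s" "sat \<tau> M (\<psi> j) s'" for j s s' k
    using diff_closed_minus[of "oadd \<epsilon> \<zeta>" "\<psi> j" s s' k] succ_ex that by blast
  let ?\<phi> = "Exists ?V (Conj J \<psi>)"
  have "sat \<tau> M ?\<phi> k" if k: "\<forall>i<\<epsilon>. k i = zero_int M" for k
  proof -
    let ?t = "\<lambda>i. if i \<in> ?V then zero_int M else k i"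
    have "\<forall>j\<in>J. sat \<tau> M (\<psi> j) ?t"
      using k by (intro ballI zero) auto
    then show ?thesis by (auto intro!: exI[of _ ?t])
  qed
  moreover have "sat \<tau> M ?\<phi> k"
    if k: "\<forall>i<\<epsilon>. s i \<in> U \<and> s' i \<in> U \<and> k i = s i -\<^sub>M s' i"
      and s: "sat \<tau> M ?\<phi> s" "sat \<tau> M ?\<phi> s'" for s s' k
  proof -
    obtain t where t: "\<forall>i. i \<notin> ?V \<longrightarrow> t i = s i" "\<forall>i\<in>?V. t i \<in> U" "\<forall>j\<in>J. sat \<tau> M (\<psi> j) t"
      using s(1) by auto
    obtain t' where t': "\<forall>i. i \<notin> ?V \<longrightarrow> t' i = s' i" "\<forall>i\<in>?V. t' i \<in> U" "\<forall>j\<in>J. sat \<tau> M (\<psi> j) t'"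
      using s(2) by auto
    let ?t = "\<lambda>i. if i \<in> ?V then t i -\<^sub>M t' i else k i"
    have tt: "t i \<in> U \<and> t' i \<in> U \<and> ?t i = t i -\<^sub>M t' i" if "i < oadd \<epsilon> \<zeta>" for i
      using t t' k that by (cases "i < \<epsilon>") auto
    have "sat \<tau> M (\<psi> j) ?t" if j: "j \<in> J" for j
      by (rule diff[OF j _ bspec[OF t(3) j] bspec[OF t'(3) j]]) (use tt in blast)
    moreover have "\<forall>i\<in>?V. ?t i \<in> U" using t(2) t'(2) by simp
    ultimately show ?thesis unfolding sat.simps by (intro exI[of _ ?t]) auto
  qed
  ultimately show ?case unfolding diff_closed_def by blast
qed (auto intro: diff_closed_atomic)

text \<open>Subtracting the zero assignment from \<open>s\<close> gives \<open>s\<close> again below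
  \<open>\<eta>\<close>, so locality is a case of closure under differences.\<close>

lemma diff_closed_cong:
  assumes "diff_closed \<eta> \<phi>" "\<And>i. i < \<eta> \<Longrightarrow> s i \<in> U \<and> k i = s i" "sat \<tau> M \<phi> s"
  shows "sat \<tau> M \<phi> k"
proof (rule diff_closed_minus[OF assms(1) _ assms(3)])
  show "sat \<tau> M \<phi> (\<lambda>_. zero_int M)"
    by (rule diff_closed_zero[OF assms(1)]) simp
  show "s i \<in> U \<and> zero_int M \<in> U \<and> k i = s i -\<^sub>M zero_int M" if "i < \<eta>" for i
    using assms(2)[OF that] by simp
qed

lemma diff_closed_solutions:
  assumes "diff_closed \<eta> \<phi>"
  shows "(\<lambda>i\<in>{..<\<eta>}. zero_int M) \<in> solutions \<tau> M \<eta> \<phi>"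
    and "x \<in> solutions \<tau> M \<eta> \<phi> \<Longrightarrow> y \<in> solutions \<tau> M \<eta> \<phi> \<Longrightarrow> seq_diff M \<eta> x y \<in> solutions \<tau> M \<eta> \<phi>"
proof -
  have "sat \<tau> M \<phi> (\<lambda>i\<in>{..<\<eta>}. zero_int M)"
    by (rule diff_closed_zero[OF assms]) simp
  then show "(\<lambda>i\<in>{..<\<eta>}. zero_int M) \<in> solutions \<tau> M \<eta> \<phi>"
    by (simp add: solutions_def seqs_def)
  assume xy: "x \<in> solutions \<tau> M \<eta> \<phi>" "y \<in> solutions \<tau> M \<eta> \<phi>"
  then have "\<forall>i<\<eta>. x i \<in> U \<and> y i \<in> U \<and> seq_diff M \<eta> x y i = x i -\<^sub>M y i"
    by (auto simp: solutions_def seqs_def seq_diff_def)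
  moreover from this have "seq_diff M \<eta> x y \<in> seqs \<eta> U"
    by (auto simp: seqs_def seq_diff_def)
  ultimately show "seq_diff M \<eta> x y \<in> solutions \<tau> M \<eta> \<phi>"
    using diff_closed_minus[OF assms, of x y "seq_diff M \<eta> x y"] xy unfolding solutions_def by blast
qed

end

section \<open>Counting solution sets\<close>

lemma card_of_Pow_le:
  assumes "|A| \<le>o K" "Card_order K"
  shows "|Pow A| \<le>o ctwo ^c K"
proof -
  have "|A| \<le>o |Field K|"
    using ordLeq_ordIso_trans[OF assms(1) ordIso_symmetric[OF card_of_Field_ordIso[OF assms(2)]]] .
  then obtain f where f: "inj_on f A" "f ` A \<subseteq> Field K"
    using card_of_ordLeq by metis
  have "|Pow A| \<le>o |Pow (Field K)|"
    by (rule card_of_ordLeqI[OF inj_on_image_Pow[OF f(1)]]) (use f(2) in auto)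
  also have "|Pow (Field K)| =o ctwo ^c K"
    using card_of_Pow_Func[of "Field K"] by (simp add: cexp_def ctwo_def Field_card_of)
  finally show ?thesis .
qed

lemma Cinfinite_ctwo: "Cinfinite K \<Longrightarrow> Cinfinite (ctwo ^c K)"
  by (intro Cinfinite_cexp ordLeq_refl Card_order_ctwo)

lemma ctwo_mono: "Cinfinite p \<Longrightarrow> p \<le>o q \<Longrightarrow> ctwo ^c p \<le>o ctwo ^c q"
  by (intro cexp_mono2_Cnotzero Card_order_ctwo Cinfinite_Cnotzero)

lemma le_ctwo: "Card_order K \<Longrightarrow> K \<le>o ctwo ^c K"
  by (intro ordLess_imp_ordLeq ordLess_ctwo_cexp)

lemma card_of_Times_le: "Cinfinite K \<Longrightarrow> |A| \<le>o K \<Longrightarrow> |B| \<le>o K \<Longrightarrow> |A \<times> B| \<le>o K"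
  by (intro card_of_Times_ordLeq_infinite_Field) (auto simp: cinfinite_def)

lemma card_of_Plus_le: "Cinfinite K \<Longrightarrow> |A| \<le>o K \<Longrightarrow> |B| \<le>o K \<Longrightarrow> |A <+> B| \<le>o K"
  by (intro card_of_Plus_ordLeq_infinite_Field) (auto simp: cinfinite_def)

lemma card_of_Un_le: "Cinfinite K \<Longrightarrow> |A| \<le>o K \<Longrightarrow> |B| \<le>o K \<Longrightarrow> |A \<union> B| \<le>o K"
  by (intro card_of_Un_ordLeq_infinite_Field) (auto simp: cinfinite_def)

lemma card_of_UNION_le:
  "Cinfinite K \<Longrightarrow> |I| \<le>o K \<Longrightarrow> (\<And>i. i \<in> I \<Longrightarrow> |A i| \<le>o K) \<Longrightarrow> |\<Union>i\<in>I. A i| \<le>o K"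
  by (intro card_of_UNION_ordLeq_infinite_Field) (auto simp: cinfinite_def)

lemma card_of_lists_le:
  fixes A :: "'a set"
  assumes K: "Cinfinite K" and A: "|A| \<le>o K"
  shows "|lists A| \<le>o K"
proof -
  let ?L = "\<lambda>n. {xs \<in> lists A. length xs = n}"
  have "|?L n| \<le>o K" for n
  proof (induction n)
    case 0
    have "?L 0 = {[]}" by auto
    moreover have "|{[] :: 'a list}| \<le>o K"
      using K by (intro Card_order_singl_ordLeq) (auto simp: cinfinite_def)
    ultimately show ?case by simp
  next
    case (Suc n)
    have "?L (Suc n) \<subseteq> (\<lambda>(x, xs). x # xs) ` (A \<times> ?L n)"
      by (auto simp: length_Suc_conv image_iff)
    then have "|?L (Suc n)| \<le>o |A \<times> ?L n|" by (rule surj_imp_ordLeq)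
    also have "|A \<times> ?L n| \<le>o K" by (rule card_of_Times_le[OF K A Suc])
    finally show ?case .
  qed
  moreover have "|UNIV :: nat set| \<le>o K"
    using natLeq_ordLeq_cinfinite[OF K] card_of_nat ordIso_ordLeq_trans by blast
  ultimately have "|\<Union>n. ?L n| \<le>o K"
    by (intro card_of_UNION_le[OF K]) auto
  moreover have "(\<Union>n. ?L n) = lists A" by auto
  ultimately show ?thesis by simp
qed

section \<open>Atomic formulas and their codes\<close>

lemma terms_mono: "t \<in> terms \<tau> \<eta> \<Longrightarrow> \<eta> \<le> \<theta> \<Longrightarrow> t \<in> terms \<tau> \<theta>"
  by (induction rule: terms.induct) (auto intro: terms.intros)

lemma atomic_fms_mono:
  assumes "\<eta> \<le> \<theta>"
  shows "atomic_fms \<tau> \<eta> \<subseteq> atomic_fms \<tau> \<theta>"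
proof -
  have "terms \<tau> \<eta> \<subseteq> terms \<tau> \<theta>" using terms_mono assms by blast
  moreover from this have "seqs \<alpha> (terms \<tau> \<eta>) \<subseteq> seqs \<alpha> (terms \<tau> \<theta>)" for \<alpha>
    unfolding seqs_def by (intro PiE_mono) auto
  ultimately show ?thesis unfolding atomic_fms_def by blast
qed

text \<open>A term is a well-founded tree; it is coded by the labels found along its finite paths.\<close>

primrec term_code :: "('o::wellorder, 'f, 'p) vocab \<Rightarrow> ('o, 'f) trm \<Rightarrow> 'o list \<Rightarrow> 'o + ('f, 'p) symbol"
  where
    "term_code \<tau> (Var i) = (\<lambda>p. Inl i)"
  | "term_code \<tau> Zero = (\<lambda>p. Inr Zero_sym)"
  | "term_code \<tau> (Plus t u) = (\<lambda>p. case p of [] \<Rightarrow> Inr Plus_sym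
      | j # q \<Rightarrow> if j = ozero then term_code \<tau> t q else term_code \<tau> u q)"
  | "term_code \<tau> (Minus t u) = (\<lambda>p. case p of [] \<Rightarrow> Inr Minus_sym
      | j # q \<Rightarrow> if j = ozero then term_code \<tau> t q else term_code \<tau> u q)"
  | "term_code \<tau> (Fn F ts) = (\<lambda>p. case p of [] \<Rightarrow> Inr (Fun_sym F)
      | j # q \<Rightarrow> if j < fun_arity \<tau> F then term_code \<tau> (ts j) q else Inr Zero_sym)"

text \<open>An atom is a tree with one more level. \<open>Zero_sym\<close> at the root marks an
  equation and cannot be confused with a \<open>Pred_sym\<close>.\<close>

fun atom_code :: "('o::wellorder, 'f, 'p) vocab \<Rightarrow> ('o, 'f, 'p, 'i) fm \<Rightarrow> 'o list \<Rightarrow> 'o + ('f, 'p) symbol"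
  where
    "atom_code \<tau> (Eq t u) [] = Inr Zero_sym"
  | "atom_code \<tau> (Eq t u) (j # q) = (if j = ozero then term_code \<tau> t q else term_code \<tau> u q)"
  | "atom_code \<tau> (Rel P ts) [] = Inr (Pred_sym P)"
  | "atom_code \<tau> (Rel P ts) (j # q) =
      (if j < pred_arity \<tau> P then term_code \<tau> (ts j) q else Inr Zero_sym)"
  | "atom_code \<tau> _ _ = Inr Zero_sym"

lemma term_code_range:
  "t \<in> terms \<tau> \<theta> \<Longrightarrow> term_code \<tau> t p \<in> {..<\<theta>} <+> symbols \<tau>"
proof (induction arbitrary: p rule: terms.induct)
  case (Fn F ts)
  then show ?case by (cases p) (auto simp: symbols_def)
next
  case (Plus t u)
  then show ?case by (cases p) (auto simp: symbols_def)
next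
  case (Minus t u)
  then show ?case by (cases p) (auto simp: symbols_def)
qed (auto simp: symbols_def)

lemma ozero_oone:
  fixes \<theta> :: "'o::wellorder"
  assumes "is_limit \<theta>"
  shows "ozero < \<theta>" "oone < \<theta>" "oone \<noteq> (ozero :: 'o)"
proof -
  show z: "ozero < \<theta>"
    using assms ozero_least[of \<theta>] by (auto simp: is_limit_def le_less)
  obtain \<delta> where \<delta>: "ozero < \<delta>" "\<delta> < \<theta>"
    using assms z by (auto simp: is_limit_def)
  have "ozero < (oone :: 'o)"
    unfolding oone_def by (rule LeastI[of "\<lambda>x. ozero < x", OF \<delta>(1)])
  then show "oone \<noteq> (ozero :: 'o)" by simp
  have "oone \<le> \<delta>" unfolding oone_def by (rule Least_le[of "\<lambda>x. ozero < x", OF \<delta>(1)])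
  then show "oone < \<theta>" using \<delta>(2) by simp
qed

text \<open>The empty path reveals the head symbol, and the paths starting with \<open>j\<close>
  form the code of the subterm at child \<open>j\<close>. Paths with entries below
  \<open>\<theta>\<close> suffice, because arities are below \<open>\<theta>\<close> and the limit
  \<open>\<theta>\<close> exceeds both \<open>ozero\<close> and \<open>oone\<close>, which address
  the two children of a sum or difference.\<close>

lemma term_code_inj:
  assumes \<theta>: "is_limit \<theta>" and \<tau>: "additive_vocab \<theta> \<tau>"
  shows "t \<in> terms \<tau> \<theta> \<Longrightarrow> u \<in> terms \<tau> \<theta> \<Longrightarrow>
    (\<And>p. p \<in> lists {..<\<theta>} \<Longrightarrow> term_code \<tau> t p = term_code \<tau> u p) \<Longrightarrow> t = u"
proof (induction arbitrary: u rule: terms.induct)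
  case (Var i)
  then show ?case using Var.prems(2)[of "[]"] by (cases u) auto
next
  case Zero
  then show ?case using Zero.prems(2)[of "[]"] by (cases u) auto
next
  case (Plus t1 t2)
  from Plus.prems(2)[of "[]"] obtain u1 u2 where u: "u = trm.Plus u1 u2"
    by (cases u) auto
  with Plus.prems(1) have "u1 \<in> terms \<tau> \<theta>" "u2 \<in> terms \<tau> \<theta>"
    by (auto elim: terms.cases)
  moreover have "term_code \<tau> t1 q = term_code \<tau> u1 q" "term_code \<tau> t2 q = term_code \<tau> u2 q"
    if "q \<in> lists {..<\<theta>}" for q
    using Plus.prems(2)[of "ozero # q"] Plus.prems(2)[of "oone # q"] that u ozero_oone[OF \<theta>] by auto
  ultimately show ?case using Plus.IH u by blast
next
  case (Minus t1 t2)
  from Minus.prems(2)[of "[]"] obtain u1 u2 where u: "u = trm.Minus u1 u2"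
    by (cases u) auto
  with Minus.prems(1) have "u1 \<in> terms \<tau> \<theta>" "u2 \<in> terms \<tau> \<theta>"
    by (auto elim: terms.cases)
  moreover have "term_code \<tau> t1 q = term_code \<tau> u1 q" "term_code \<tau> t2 q = term_code \<tau> u2 q"
    if "q \<in> lists {..<\<theta>}" for q
    using Minus.prems(2)[of "ozero # q"] Minus.prems(2)[of "oone # q"] that u ozero_oone[OF \<theta>] by auto
  ultimately show ?case using Minus.IH u by blast
next
  case (Fn F ts)
  from Fn.prems(2)[of "[]"] obtain us where u: "u = trm.Fn F us"
    by (cases u) auto
  with Fn.prems(1) have us: "\<forall>i<fun_arity \<tau> F. us i \<in> terms \<tau> \<theta>" "us \<in> extensional {..<fun_arity \<tau> F}"
    by (auto elim: terms.cases)
  have "fun_arity \<tau> F < \<theta>" using \<tau> Fn.hyps(1) by (simp add: additive_vocab_def)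
  have "ts i = us i" if i: "i < fun_arity \<tau> F" for i
  proof -
    have "term_code \<tau> (ts i) q = term_code \<tau> (us i) q" if "q \<in> lists {..<\<theta>}" for q
      using Fn.prems(2)[of "i # q"] that i \<open>fun_arity \<tau> F < \<theta>\<close> u by auto
    then show ?thesis using Fn.IH us(1) i by blast
  qed
  \<comment> \<open>Agreement below the arity gives equality of functions, since
    \<open>terms\<close> admits only extensional argument families.\<close>
  then have "ts = us"
    using Fn.hyps us(2) by (intro extensionalityI[of ts "{..<fun_arity \<tau> F}" us]) auto
  then show ?case using u by simp
qed

lemma atom_code_inj:
  assumes \<theta>: "is_limit \<theta>" and \<tau>: "additive_vocab \<theta> \<tau>"
    and "\<phi> \<in> atomic_fms \<tau> \<theta>" "\<psi> \<in> atomic_fms \<tau> \<theta>"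
    and eq: "\<And>p. p \<in> lists {..<\<theta>} \<Longrightarrow> atom_code \<tau> \<phi> p = atom_code \<tau> \<psi> p"
  shows "\<phi> = \<psi>"
proof -
  consider t u where "\<phi> = Eq t u" "t \<in> terms \<tau> \<theta>" "u \<in> terms \<tau> \<theta>"
    | P ts where "\<phi> = Rel P ts" "P \<in> preds \<tau>" "ts \<in> seqs (pred_arity \<tau> P) (terms \<tau> \<theta>)"
    using assms(3) by (auto simp: atomic_fms_def)
  then show ?thesis
  proof cases
    case 1
    then obtain t' u' where \<psi>: "\<psi> = Eq t' u'" "t' \<in> terms \<tau> \<theta>" "u' \<in> terms \<tau> \<theta>"
      using assms(4) eq[of "[]"] by (auto simp: atomic_fms_def)
    have "term_code \<tau> t q = term_code \<tau> t' q" "term_code \<tau> u q = term_code \<tau> u' q"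
      if "q \<in> lists {..<\<theta>}" for q
      using eq[of "ozero # q"] eq[of "oone # q"] that ozero_oone[OF \<theta>] 1(1) \<psi>(1) by auto
    then have "t = t'" "u = u'"
      using term_code_inj[OF \<theta> \<tau>] 1 \<psi> by blast+
    then show ?thesis using 1(1) \<psi>(1) by simp
  next
    case 2
    then obtain us where \<psi>: "\<psi> = Rel P us" "us \<in> seqs (pred_arity \<tau> P) (terms \<tau> \<theta>)"
      using assms(4) eq[of "[]"] by (auto simp: atomic_fms_def)
    have "pred_arity \<tau> P < \<theta>" using \<tau> 2(2) by (simp add: additive_vocab_def)
    have "ts i = us i" if i: "i < pred_arity \<tau> P" for i
    proof -
      have "term_code \<tau> (ts i) q = term_code \<tau> (us i) q" if "q \<in> lists {..<\<theta>}" for q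
        using eq[of "i # q"] that i \<open>pred_arity \<tau> P < \<theta>\<close> 2(1) \<psi>(1) by auto
      moreover have "ts i \<in> terms \<tau> \<theta>" "us i \<in> terms \<tau> \<theta>"
        using 2(3) \<psi>(2) i by (auto simp: seqs_def)
      ultimately show ?thesis using term_code_inj[OF \<theta> \<tau>] by blast
    qed
    then have "ts = us"
      using 2(3) \<psi>(2) unfolding seqs_def by (intro PiE_ext) auto
    then show ?thesis using 2(1) \<psi>(1) by simp
  qed
qed

text \<open>With infinite arities there may be more than \<open>K\<close> terms. A code is a set of
  pairs of a finite path and a label, hence a subset of a set of size at most
  \<open>K\<close>.\<close>

lemma card_of_atomic_fms:
  assumes \<theta>: "is_limit \<theta>" and \<tau>: "additive_vocab \<theta> \<tau>"
    and K: "Cinfinite K" "|{..<\<theta>}| \<le>o K" "|symbols \<tau>| \<le>o K"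
  shows "|atomic_fms \<tau> \<theta> :: ('o::wellorder, 'f, 'p, 'i) fm set| \<le>o ctwo ^c K"
proof -
  let ?P = "lists {..<\<theta>}" and ?L = "{..<\<theta>} <+> symbols \<tau>"
  let ?code = "\<lambda>\<phi> :: ('o, 'f, 'p, 'i) fm. {(p, atom_code \<tau> \<phi> p) |p. p \<in> ?P}"
  have "inj_on ?code (atomic_fms \<tau> \<theta>)"
    using atom_code_inj[OF \<theta> \<tau>] by (intro inj_onI) blast
  moreover have "atom_code \<tau> \<phi> p \<in> ?L" if "\<phi> \<in> atomic_fms \<tau> \<theta>" for \<phi> :: "('o, 'f, 'p, 'i) fm" and p
    using that term_code_range[of _ \<tau> \<theta>]
    by (cases p; cases \<phi>) (auto simp: atomic_fms_def symbols_def seqs_def PiE_iff)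
  then have "?code ` atomic_fms \<tau> \<theta> \<subseteq> Pow (?P \<times> ?L)"
    by auto
  ultimately have "|atomic_fms \<tau> \<theta> :: ('o, 'f, 'p, 'i) fm set| \<le>o |Pow (?P \<times> ?L)|"
    using card_of_ordLeq by blast
  also have "|Pow (?P \<times> ?L)| \<le>o ctwo ^c K"
    using K by (intro card_of_Pow_le card_of_Times_le card_of_lists_le card_of_Plus_le) auto
  finally show ?thesis .
qed

section \<open>Levels of the hierarchy and numbers of solution sets\<close>

lemma is_limit_not_succ: "is_limit \<alpha> \<Longrightarrow> \<not> is_succ \<beta> \<alpha>"
  by (auto simp: is_limit_def is_succ_def not_le)

lemma is_succ_unique: "is_succ \<beta> \<alpha> \<Longrightarrow> is_succ \<beta>' \<alpha> \<Longrightarrow> \<beta> = \<beta>'"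
  by (metis is_succ_def linorder_neqE not_le)

lemma not_is_succ_ozero: "\<not> is_succ \<beta> ozero"
  by (simp add: is_succ_def not_less_ozero)

lemma not_is_limit_ozero: "\<not> is_limit ozero"
  by (simp add: is_limit_def)

lemma is_beth_succD:
  assumes "is_succ \<beta> \<alpha>" "is_beth r \<alpha> \<kappa>'"
  obtains \<kappa> where "is_beth r \<beta> \<kappa>" "cardinal \<kappa>'" "ord_rel \<kappa>' =o ctwo ^c ord_rel \<kappa>"
  using assms(2)
proof cases
  case zero
  then show thesis using assms(1) by (simp add: not_is_succ_ozero)
next
  case (succ \<beta>' \<kappa>)
  then show thesis using that is_succ_unique assms(1) by blast
next
  case limit
  then show thesis using assms(1) is_limit_not_succ by blast
qed

lemma Well_order_ord_rel: "Well_order (ord_rel \<alpha>)"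
proof -
  have "wf (ord_rel \<alpha> - Id)"
    by (rule wf_subset[OF wf]) (auto simp: in_ord_rel)
  moreover have "linear_order_on {..<\<alpha>} (ord_rel \<alpha>)"
    unfolding linear_order_on_def partial_order_on_def preorder_on_def
    by (auto simp: refl_on_def trans_def antisym_def total_on_def in_ord_rel)
  ultimately show ?thesis by (simp add: well_order_on_def)
qed

text \<open>Meant for the limit clause of \<open>is_beth\<close>, which says only that
  \<open>\<kappa>\<close> is a supremum of cardinals. Every proper initial segment of
  \<open>\<kappa>\<close> lies in some cardinal \<open>\<sigma>\<close> and is smaller than
  it.\<close>

lemma cardinal_sup:
  assumes "\<And>i. i < \<kappa> \<Longrightarrow> \<exists>\<sigma>\<le>\<kappa>. cardinal \<sigma> \<and> i < \<sigma>"
  shows "cardinal \<kappa>"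
proof -
  have "ord_rel i <o |{..<\<kappa>}|" if i: "i < \<kappa>" for i
  proof -
    obtain \<sigma> where \<sigma>: "\<sigma> \<le> \<kappa>" "cardinal \<sigma>" "i < \<sigma>" using assms[OF i] by blast
    then have "ord_rel i <o |{..<\<sigma>}|"
      using Card_order_iff_Restr_underS[OF Well_order_ord_rel, of \<sigma>]
      by (force simp: cardinal_def underS_ord_rel Restr_ord_rel)
    also have "|{..<\<sigma>}| \<le>o |{..<\<kappa>}|" using \<sigma>(1) by (intro card_of_mono1) auto
    finally show ?thesis .
  qed
  then show ?thesis
    using Card_order_iff_Restr_underS[OF Well_order_ord_rel, of \<kappa>]
    by (force simp: cardinal_def underS_ord_rel Restr_ord_rel)
qed

text \<open>This set stands in for the formulas up to equivalence. All lengths below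
  \<open>\<theta>\<close> are collected at once, because a formula of length
  \<open>\<epsilon>\<close> is built from formulas of length
  \<open>oadd \<epsilon> \<zeta>\<close>.\<close>

definition solution_sets ::
    "'o::wellorder \<Rightarrow> ('o, 'f, 'p) vocab \<Rightarrow> ('o \<Rightarrow> ('o, 'f, 'p, 'i) fm set) \<Rightarrow> 'o \<Rightarrow>
      ('o, 'f, 'p, 'm) struct \<Rightarrow> ('o \<Rightarrow> 'm) set set"
  where "solution_sets \<theta> \<tau> B \<alpha> M = {solutions \<tau> M \<eta> \<phi> |\<eta> \<phi>. pe \<theta> B \<alpha> \<eta> \<phi>}"

lemma pe_less: "pe \<theta> B \<alpha> \<eta> \<phi> \<Longrightarrow> \<eta> < \<theta>"
  by (induction rule: pe.induct) auto

lemma solution_sets_limit: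
  assumes "is_limit \<alpha>"
  shows "solution_sets \<theta> \<tau> B \<alpha> M \<subseteq> (\<Union>\<beta>\<in>{..<\<alpha>}. solution_sets \<theta> \<tau> B \<beta> M)"
proof -
  have "\<exists>\<beta><\<alpha>. pe \<theta> B \<beta> \<eta> \<phi>" if "pe \<theta> B \<alpha> \<eta> \<phi>" for \<eta> \<phi>
    using that
  proof cases
    case zero
    then show ?thesis using assms not_is_limit_ozero by blast
  qed (use assms is_limit_not_succ in blast)+
  then show ?thesis unfolding solution_sets_def by blast
qed

lemma card_of_solution_sets_zero:
  fixes M :: "('o::wellorder, 'f, 'p, 'm) struct"
  assumes \<theta>: "is_limit \<theta>" and \<tau>: "additive_vocab \<theta> \<tau>"
    and K: "Cinfinite K" "|{..<\<theta>}| \<le>o K" "|symbols \<tau>| \<le>o K"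
  shows "|solution_sets \<theta> \<tau> (atomic_fms \<tau> :: _ \<Rightarrow> ('o, 'f, 'p, 'i) fm set) ozero M| \<le>o ctwo ^c K"
proof -
  \<comment> \<open>Allowing all variables below \<open>\<theta>\<close> makes one set of atomic
    formulas serve every length; the length is then recorded separately.\<close>
  have "\<phi> \<in> atomic_fms \<tau> \<theta>" if "pe \<theta> (atomic_fms \<tau>) ozero \<eta> \<phi>" for \<eta> and \<phi> :: "('o, 'f, 'p, 'i) fm"
    using that
  proof cases
    case zero
    then show ?thesis using subsetD[OF atomic_fms_mono[OF less_imp_le]] by blast
  qed (simp_all add: not_is_limit_ozero not_is_succ_ozero)
  then have "solution_sets \<theta> \<tau> (atomic_fms \<tau> :: _ \<Rightarrow> ('o, 'f, 'p, 'i) fm set) ozero M \<subseteq>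
    (\<lambda>(\<eta>, \<phi>). solutions \<tau> M \<eta> \<phi>) ` ({..<\<theta>} \<times> (atomic_fms \<tau> \<theta> :: ('o, 'f, 'p, 'i) fm set))"
    unfolding solution_sets_def using pe_less by fastforce
  then have "|solution_sets \<theta> \<tau> (atomic_fms \<tau> :: _ \<Rightarrow> ('o, 'f, 'p, 'i) fm set) ozero M| \<le>o
    |{..<\<theta>} \<times> (atomic_fms \<tau> \<theta> :: ('o, 'f, 'p, 'i) fm set)|"
    by (rule surj_imp_ordLeq)
  also have "|{..<\<theta>} \<times> (atomic_fms \<tau> \<theta> :: ('o, 'f, 'p, 'i) fm set)| \<le>o ctwo ^c K"
    using K ordLeq_transitive[OF K(2) le_ctwo]
    by (intro card_of_Times_le Cinfinite_ctwo card_of_atomic_fms[OF \<theta> \<tau>]) auto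
  finally show ?thesis .
qed

context additive
begin

text \<open>By locality, the solution set of a conjunction under a quantifier depends only on the set of
  solution sets of its conjuncts.\<close>

lemma solutions_Exists:
  assumes pe: "\<forall>j\<in>J. pe \<theta> (atomic_fms \<tau>) \<beta> (oadd \<epsilon> \<zeta>) (\<psi> j)"
  shows "solutions \<tau> M \<epsilon> (Exists {\<epsilon>..<oadd \<epsilon> \<zeta>} (Conj J \<psi>)) =
    {b \<in> seqs \<epsilon> U. \<exists>d \<in> seqs (oadd \<epsilon> \<zeta>) U \<inter> \<Inter> ((\<lambda>j. solutions \<tau> M (oadd \<epsilon> \<zeta>) (\<psi> j)) ` J).
       \<forall>i. i < \<epsilon> \<and> i < oadd \<epsilon> \<zeta> \<longrightarrow> d i = b i}"
    (is "?L = ?R")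
proof (intro equalityI subsetI)
  let ?V = "{\<epsilon>..<oadd \<epsilon> \<zeta>}"
  \<comment> \<open>Assignments under the quantifier and elements of \<open>seqs\<close> differ only
    from \<open>oadd \<epsilon> \<zeta>\<close> on, where locality of the conjuncts ignores
    them.\<close>
  have cong: "sat \<tau> M (\<psi> j) k"
    if "j \<in> J" "sat \<tau> M (\<psi> j) s" "\<And>i. i < oadd \<epsilon> \<zeta> \<Longrightarrow> s i \<in> U \<and> k i = s i" for j s k
    using diff_closed_cong[OF diff_closed_pe that(3,2)] pe that(1) by blast
  {
    fix b assume b: "b \<in> ?L"
    then have "sat \<tau> M (Exists ?V (Conj J \<psi>)) b" by (simp add: solutions_def)
    then obtain s where s: "\<And>i. i \<notin> ?V \<Longrightarrow> s i = b i" "\<And>i. i \<in> ?V \<Longrightarrow> s i \<in> U"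
      "\<And>j. j \<in> J \<Longrightarrow> sat \<tau> M (\<psi> j) s"
      unfolding sat.simps by blast
    have bU: "b i \<in> U" if "i < \<epsilon>" for i
      using b that by (auto simp: solutions_def seqs_def)
    define d where "d = restrict s {..<oadd \<epsilon> \<zeta>}"
    have sU: "s i \<in> U" if "i < oadd \<epsilon> \<zeta>" for i
      using s(1,2)[of i] bU[of i] that by (cases "i < \<epsilon>") auto
    then have d: "d \<in> seqs (oadd \<epsilon> \<zeta>) U" by (auto simp: d_def seqs_def)
    have "sat \<tau> M (\<psi> j) d" if "j \<in> J" for j
      by (rule cong[OF that s(3)[OF that]]) (simp add: sU d_def)
    moreover have "d i = b i" if "i < \<epsilon>" "i < oadd \<epsilon> \<zeta>" for i
      using s(1)[of i] that by (simp add: d_def)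
    ultimately show "b \<in> ?R" using b d by (auto simp: solutions_def)
  next
    fix b assume b: "b \<in> ?R"
    then obtain d where d: "d \<in> seqs (oadd \<epsilon> \<zeta>) U" "\<And>j. j \<in> J \<Longrightarrow> sat \<tau> M (\<psi> j) d"
      "\<And>i. i < \<epsilon> \<Longrightarrow> i < oadd \<epsilon> \<zeta> \<Longrightarrow> d i = b i"
      by (auto simp: solutions_def)
    have dU: "d i \<in> U" if "i < oadd \<epsilon> \<zeta>" for i
      using d(1) that by (auto simp: seqs_def)
    define s where "s i = (if i \<in> ?V then d i else b i)" for i
    have "sat \<tau> M (\<psi> j) s" if "j \<in> J" for j
      by (rule cong[OF that d(2)[OF that]]) (auto simp: dU s_def d(3))
    then have "sat \<tau> M (Exists ?V (Conj J \<psi>)) b"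
      unfolding sat.simps using dU by (intro exI[of _ s]) (auto simp: s_def)
    then show "b \<in> ?L" using b by (simp add: solutions_def)
  }
qed

text \<open>A solution set new at this level is determined by two lengths below
  \<open>\<theta>\<close> and a set of solution sets of the level before, which gives at most 2^K
  possibilities however large the conjunction is.\<close>

lemma card_of_solution_sets_succ:
  assumes "is_succ \<beta> \<alpha>"
    and K: "Cinfinite K" "|{..<\<theta>}| \<le>o K"
      "|solution_sets \<theta> \<tau> (atomic_fms \<tau> :: _ \<Rightarrow> ('o, 'f, 'p, 'i) fm set) \<beta> M| \<le>o K"
  shows "|solution_sets \<theta> \<tau> (atomic_fms \<tau> :: _ \<Rightarrow> ('o, 'f, 'p, 'i) fm set) \<alpha> M| \<le>o ctwo ^c K"
proof -
  let ?B = "atomic_fms \<tau> :: _ \<Rightarrow> ('o, 'f, 'p, 'i) fm set"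
  let ?S = "solution_sets \<theta> \<tau> ?B \<beta> M"
  let ?F = "\<lambda>((\<epsilon>, \<zeta>), Y). {b \<in> seqs \<epsilon> U. \<exists>d \<in> seqs (oadd \<epsilon> \<zeta>) U \<inter> \<Inter> Y.
       \<forall>i. i < \<epsilon> \<and> i < oadd \<epsilon> \<zeta> \<longrightarrow> d i = b i}"
  let ?D = "({..<\<theta>} \<times> {..<\<theta>}) \<times> Pow ?S"
  have "solutions \<tau> M \<eta> \<phi> \<in> ?S \<union> ?F ` ?D" if "pe \<theta> ?B \<alpha> \<eta> \<phi>" for \<eta> \<phi>
    using that
  proof cases
    case zero
    then show ?thesis using assms(1) not_is_succ_ozero by blast
  next
    case limit
    then show ?thesis using assms(1) is_limit_not_succ by blast
  next
    case (succ \<beta>')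
    then show ?thesis using is_succ_unique[OF assms(1)] unfolding solution_sets_def by blast
  next
    case (succ_ex \<beta>' \<zeta> J \<psi>)
    then have \<psi>: "\<forall>j\<in>J. pe \<theta> ?B \<beta> (oadd \<eta> \<zeta>) (\<psi> j)"
      using is_succ_unique[OF assms(1)] by blast
    let ?Y = "(\<lambda>j. solutions \<tau> M (oadd \<eta> \<zeta>) (\<psi> j)) ` J"
    have mem: "((\<eta>, \<zeta>), ?Y) \<in> ?D"
      using \<psi> succ_ex unfolding solution_sets_def by auto
    have eq: "solutions \<tau> M \<eta> \<phi> = ?F ((\<eta>, \<zeta>), ?Y)"
      using solutions_Exists[OF \<psi>] succ_ex(1) by simp
    show ?thesis unfolding eq by (rule UnI2[OF imageI[OF mem]])
  qed
  then have "solution_sets \<theta> \<tau> ?B \<alpha> M \<subseteq> ?S \<union> ?F ` ?D"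
    unfolding solution_sets_def[of _ _ _ \<alpha>] by blast
  then have "|solution_sets \<theta> \<tau> ?B \<alpha> M| \<le>o |?S \<union> ?F ` ?D|"
    by (rule card_of_mono1)
  also have "|?S \<union> ?F ` ?D| \<le>o ctwo ^c K"
  proof (rule card_of_Un_le)
    have le: "K \<le>o ctwo ^c K" using K(1) by (simp add: le_ctwo)
    show "Cinfinite (ctwo ^c K)" using K(1) by (rule Cinfinite_ctwo)
    show "|?S| \<le>o ctwo ^c K" using ordLeq_transitive[OF K(3) le] .
    have "|?F ` ?D| \<le>o |?D|" by (rule card_of_image)
    also have "|?D| \<le>o ctwo ^c K"
      using K ordLeq_transitive[OF K(2) le]
      by (intro card_of_Times_le Cinfinite_ctwo card_of_Pow_le) auto
    finally show "|?F ` ?D| \<le>o ctwo ^c K" .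
  qed
  finally show ?thesis .
qed

end

section \<open>Ordinal addition and concatenation\<close>

lemma oadd_props:
  assumes \<theta>: "regular_cardinal \<theta>" and \<epsilon>: "\<epsilon> < \<theta>"
  shows "\<zeta> < \<theta> \<Longrightarrow> oadd \<epsilon> \<zeta> < \<theta> \<and> \<epsilon> \<le> oadd \<epsilon> \<zeta> \<and> (\<forall>\<zeta>'<\<zeta>. oadd \<epsilon> \<zeta>' < oadd \<epsilon> \<zeta>)"
proof (induction \<zeta> rule: less_induct)
  case (less \<zeta>)
  \<comment> \<open>\<open>LEAST\<close> in \<open>oadd\<close> has a meaning only if a bound
    exists. Regularity of \<open>\<theta>\<close> gives one, since the fewer than
    \<open>\<theta>\<close> earlier sums lie below \<open>\<theta>\<close> by induction.\<close>
  have sub: "oadd \<epsilon> ` {..<\<zeta>} \<subseteq> {..<\<theta>}"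
    using less by (auto dest: less_trans)
  have "|oadd \<epsilon> ` {..<\<zeta>}| <o ord_rel \<theta>"
    using ordLeq_ordLess_trans[OF card_of_image card_of_initial_less] \<theta> less.prems
    by (auto simp: regular_cardinal_def)
  from regular_bounded[OF \<theta> sub this]
  obtain b where b: "b < \<theta>" "\<And>\<zeta>'. \<zeta>' < \<zeta> \<Longrightarrow> oadd \<epsilon> \<zeta>' < b" by auto
  let ?P = "\<lambda>\<delta>. \<epsilon> \<le> \<delta> \<and> (\<forall>\<zeta>'\<in>{..<\<zeta>}. oadd \<epsilon> \<zeta>' < \<delta>)"
  have eq: "oadd \<epsilon> \<zeta> = (LEAST \<delta>. ?P \<delta>)" by (rule oadd.simps)
  have P: "?P (max \<epsilon> b)" using b(2) by (auto simp: less_max_iff_disj)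
  have "oadd \<epsilon> \<zeta> \<le> max \<epsilon> b" unfolding eq by (rule Least_le[of ?P, OF P])
  moreover have "?P (oadd \<epsilon> \<zeta>)" unfolding eq by (rule LeastI[of ?P, OF P])
  ultimately show ?case using \<epsilon> b(1) by (auto intro: le_less_trans)
qed

lemma oadd_inj:
  assumes "regular_cardinal \<theta>" "\<epsilon> < \<theta>" "i < \<theta>" "j < \<theta>" "oadd \<epsilon> i = oadd \<epsilon> j"
  shows "i = j"
  using oadd_props[OF assms(1,2,3)] oadd_props[OF assms(1,2,4)] assms(5)
  by (metis less_irrefl linorder_neqE)

text \<open>Left subtraction: for the least \<open>j\<close> with
  \<open>i \<le> oadd \<epsilon> j\<close>, all earlier sums are below \<open>i\<close>, so
  \<open>i\<close> satisfies the condition whose least solution is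
  \<open>oadd \<epsilon> j\<close>.\<close>

lemma oadd_decompose:
  assumes "\<epsilon> \<le> i" "i < oadd \<epsilon> \<xi>"
  obtains j where "j < \<xi>" "oadd \<epsilon> j = i"
proof -
  define j where "j = (LEAST j. i \<le> oadd \<epsilon> j)"
  have i: "i \<le> oadd \<epsilon> \<xi>" using assms(2) by simp
  have j: "i \<le> oadd \<epsilon> j" "j \<le> \<xi>"
    unfolding j_def by (rule LeastI Least_le, fact i)+
  have below: "oadd \<epsilon> \<zeta> < i" if "\<zeta> < j" for \<zeta>
    using not_less_Least[OF that[unfolded j_def]] by simp
  have "oadd \<epsilon> j \<le> i"
    unfolding oadd.simps[of \<epsilon> j] using assms(1) below by (intro Least_le) auto
  then have "oadd \<epsilon> j = i" using j(1) by simp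
  moreover from this have "j \<noteq> \<xi>" using assms(2) by auto
  ultimately show thesis using that[of j] j(2) by simp
qed

lemma seq_append_left: "i < oadd \<epsilon> \<xi> \<Longrightarrow> i < \<epsilon> \<Longrightarrow> seq_append \<epsilon> \<xi> a b i = a i"
  by (simp add: seq_append_def)

lemma seq_append_right:
  assumes "regular_cardinal \<theta>" "\<epsilon> < \<theta>" "\<xi> < \<theta>" "b \<in> seqs \<xi> A" "\<epsilon> \<le> i" "i < oadd \<epsilon> \<xi>"
  shows "seq_append \<epsilon> \<xi> a b i \<in> A"
proof -
  obtain j where j: "j < \<xi>" "oadd \<epsilon> j = i" using oadd_decompose assms(5,6) by blast
  have "(THE j. j < \<xi> \<and> oadd \<epsilon> j = i) = j"
  proof (rule the_equality)
    show "k = j" if "k < \<xi> \<and> oadd \<epsilon> k = i" for k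
      using oadd_inj[OF assms(1,2), of k j] that j assms(3) by (meson less_trans)
  qed (use j in simp)
  then show ?thesis using assms(4-6) j(1) by (auto simp: seq_append_def seqs_def)
qed

text \<open>The base of the beth function contains \<theta>^- and not \<theta>. If \<theta> is the
  successor of \<sigma>, then \<theta> is at most 2^\<sigma>, so the difference costs one
  exponential.\<close>

lemma card_pred_props:
  assumes "regular_cardinal \<theta>"
  shows "Cinfinite (ord_rel (card_pred \<theta>))"
    and "ord_rel \<theta> \<le>o ctwo ^c ord_rel (card_pred \<theta>)"
proof -
  have \<theta>: "cardinal \<theta>" "infinite {..<\<theta>}" using assms by (auto simp: regular_cardinal_def)
  have "Cinfinite (ord_rel (card_pred \<theta>)) \<and> ord_rel \<theta> \<le>o ctwo ^c ord_rel (card_pred \<theta>)"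
  proof (cases "\<exists>\<sigma>::'a. cardinal \<sigma> \<and> ord_rel \<theta> =o cardSuc (ord_rel \<sigma>)")
    case True
    then obtain \<sigma> :: 'a where \<sigma>: "cardinal \<sigma>" "ord_rel \<theta> =o cardSuc (ord_rel \<sigma>)" by blast
    then have co: "Card_order (ord_rel \<sigma>)" by (simp add: cardinal_def)
    have unique: "\<sigma>' = \<sigma>" if \<sigma>': "cardinal \<sigma>'" "ord_rel \<theta> =o cardSuc (ord_rel \<sigma>')" for \<sigma>' :: 'a
    proof -
      have "cardSuc (ord_rel \<sigma>') =o cardSuc (ord_rel \<sigma>)"
        using ordIso_transitive[OF ordIso_symmetric[OF \<sigma>'(2)] \<sigma>(2)] .
      then have "ord_rel \<sigma>' =o ord_rel \<sigma>"
        using cardSuc_invar_ordIso[of "ord_rel \<sigma>'" "ord_rel \<sigma>"] co \<sigma>'(1) by (simp add: cardinal_def)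
      then show ?thesis
        using cardinal_le_iff[OF \<sigma>(1) \<sigma>'(1)] cardinal_le_iff[OF \<sigma>'(1) \<sigma>(1)]
        by (auto simp: ordIso_iff_ordLeq intro: antisym)
    qed
    have the: "(THE \<sigma>::'a. cardinal \<sigma> \<and> ord_rel \<theta> =o cardSuc (ord_rel \<sigma>)) = \<sigma>"
    proof (rule the_equality)
      show "cardinal \<sigma> \<and> ord_rel \<theta> =o cardSuc (ord_rel \<sigma>)" using \<sigma> by (rule conjI)
    qed (erule conjE, rule unique)
    have pred: "card_pred \<theta> = \<sigma>"
      by (rule trans[OF trans[OF card_pred_def if_P[OF True]] the])
    have "finite (Field (ord_rel \<theta>)) \<longleftrightarrow> finite (Field (cardSuc (ord_rel \<sigma>)))"
      using card_of_ordIso_finite[OF card_of_cong[OF \<sigma>(2)]] .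
    then have "infinite {..<\<sigma>}" using \<theta>(2) cardSuc_finite[OF co] by simp
    moreover have "cardSuc (ord_rel \<sigma>) \<le>o ctwo ^c ord_rel \<sigma>"
      by (rule cardSuc_least[OF co Card_order_cexp ordLess_ctwo_cexp[OF co]])
    ultimately show ?thesis
      unfolding pred using Cinfinite_ord_rel[OF \<sigma>(1)] ordIso_ordLeq_trans[OF \<sigma>(2)] by blast
  next
    case False
    then have "card_pred \<theta> = \<theta>" by (rule trans[OF card_pred_def if_not_P])
    then show ?thesis using Cinfinite_ord_rel[OF \<theta>] le_ctwo[of "ord_rel \<theta>"] by simp
  qed
  then show "Cinfinite (ord_rel (card_pred \<theta>))" "ord_rel \<theta> \<le>o ctwo ^c ord_rel (card_pred \<theta>)"
    by auto
qed

lemma Cinfinite_mono_ord: "Cinfinite r \<Longrightarrow> cardinal \<kappa> \<Longrightarrow> r \<le>o ord_rel \<kappa> \<Longrightarrow> Cinfinite (ord_rel \<kappa>)"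
  using cinfinite_mono by (auto simp: cardinal_def)

text \<open>The inequality \<open>\<alpha> \<le> \<kappa>\<close> bounds the number of levels united
  at a limit stage. It holds because the beth function is strictly increasing at successors.\<close>

lemma is_beth_ge:
  assumes "is_beth r \<alpha> \<kappa>"
  shows "cardinal \<kappa> \<and> r \<le>o ord_rel \<kappa> \<and> \<alpha> \<le> \<kappa>"
  using assms
proof induction
  case (zero \<kappa>)
  then show ?case by (simp add: ozero_least ordIso_iff_ordLeq)
next
  case (succ \<beta> \<alpha> \<kappa> \<kappa>')
  then have co: "Card_order (ord_rel \<kappa>)" by (simp add: cardinal_def)
  have less: "ord_rel \<kappa> <o ord_rel \<kappa>'"
    by (rule ordLess_ordIso_trans[OF ordLess_ctwo_cexp[OF co] ordIso_symmetric[OF succ.hyps(4)]])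
  then have "\<not> \<kappa>' \<le> \<kappa>"
    using cardinal_le_iff[of \<kappa>' \<kappa>] succ not_ordLess_ordLeq by blast
  then have "\<alpha> \<le> \<kappa>'"
    using succ by (auto simp: is_succ_def intro: le_less_trans)
  moreover have "r \<le>o ord_rel \<kappa>'"
    using succ.IH less ordLeq_ordLess_trans ordLess_imp_ordLeq by blast
  ultimately show ?case using succ.hyps(3) by simp
next
  case (limit \<alpha> b \<kappa>)
  have card: "cardinal \<kappa>"
    using limit by (intro cardinal_sup) blast
  have "ozero < \<alpha>" using ozero_oone(1)[OF limit.hyps(1)] .
  then have "r \<le>o ord_rel \<kappa>"
    using limit card cardinal_le_iff ordLeq_transitive by metis
  moreover have "\<alpha> \<le> \<kappa>"
  proof (rule ccontr)
    assume "\<not> \<alpha> \<le> \<kappa>"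
    then obtain \<delta> where "\<kappa> < \<delta>" "\<delta> < \<alpha>"
      using limit.hyps(1) by (auto simp: is_limit_def not_le)
    then show False using limit by (metis leD le_less_trans less_le_trans)
  qed
  ultimately show ?case using card by simp
qed

context additive
begin

text \<open>
  The two exponentials of slack absorb the crude count of atomic formulas and are preserved by
  successor steps; at a limit \<open>\<gamma>\<close> they disappear, as \<open>\<beta> + 2 < \<gamma>\<close> for \<open>\<beta> < \<gamma>\<close>.
\<close>

lemma card_of_solution_sets:
  fixes r :: "'x rel"
  assumes \<theta>: "is_limit \<theta>" and \<tau>: "additive_vocab \<theta> \<tau>"
    and r: "Cinfinite r" "|{..<\<theta>}| \<le>o ctwo ^c r" "|symbols \<tau>| \<le>o ctwo ^c r"
    and "is_beth r \<alpha> \<kappa>"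
  shows "|solution_sets \<theta> \<tau> (atomic_fms \<tau> :: _ \<Rightarrow> ('o, 'f, 'p, 'i) fm set) \<alpha> M|
    \<le>o ctwo ^c (ctwo ^c ord_rel \<kappa>)"
  using assms(6)
proof induction
  case (zero \<kappa>)
  have "|solution_sets \<theta> \<tau> (atomic_fms \<tau> :: _ \<Rightarrow> ('o, 'f, 'p, 'i) fm set) ozero M|
    \<le>o ctwo ^c (ctwo ^c r)"
    by (rule card_of_solution_sets_zero[OF \<theta> \<tau> Cinfinite_ctwo[OF r(1)] r(2,3)])
  also have "ctwo ^c (ctwo ^c r) \<le>o ctwo ^c (ctwo ^c ord_rel \<kappa>)"
    using zero r(1) by (intro ctwo_mono Cinfinite_ctwo) (auto dest: ordIso_symmetric simp: ordIso_iff_ordLeq)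
  finally show ?case .
next
  case (succ \<beta> \<alpha> \<kappa> \<kappa>')
  have \<kappa>: "cardinal \<kappa>" "r \<le>o ord_rel \<kappa>" using is_beth_ge succ.hyps(2) by auto
  then have inf: "Cinfinite (ord_rel \<kappa>)" using Cinfinite_mono_ord r(1) by blast
  have "|{..<\<theta>}| \<le>o ctwo ^c (ctwo ^c ord_rel \<kappa>)"
    using ordLeq_transitive[OF r(2) ordLeq_transitive[OF ctwo_mono[OF r(1) \<kappa>(2)] le_ctwo]]
      Card_order_cexp by blast
  then have "|solution_sets \<theta> \<tau> (atomic_fms \<tau> :: _ \<Rightarrow> ('o, 'f, 'p, 'i) fm set) \<alpha> M|
    \<le>o ctwo ^c (ctwo ^c (ctwo ^c ord_rel \<kappa>))"
    by (intro card_of_solution_sets_succ[OF succ.hyps(1)] Cinfinite_ctwo inf succ.IH)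
  \<comment> \<open>The new exponential is absorbed in passing from \<open>\<kappa>\<close> to
    \<open>\<kappa>'\<close>.\<close>
  also have "ctwo ^c (ctwo ^c (ctwo ^c ord_rel \<kappa>)) \<le>o ctwo ^c (ctwo ^c ord_rel \<kappa>')"
    using succ.hyps(4) by (intro ctwo_mono Cinfinite_ctwo inf) (simp add: ordIso_iff_ordLeq)
  finally show ?case .
next
  case (limit \<alpha> b \<kappa>)
  let ?T = "ctwo ^c (ctwo ^c ord_rel \<kappa>)"
  have "is_beth r \<alpha> \<kappa>" using limit by (intro is_beth.limit) auto
  then have \<kappa>: "cardinal \<kappa>" "r \<le>o ord_rel \<kappa>" "\<alpha> \<le> \<kappa>" using is_beth_ge by auto
  then have inf: "Cinfinite (ord_rel \<kappa>)" using Cinfinite_mono_ord r(1) by blast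
  have "|{..<\<alpha>}| \<le>o |{..<\<kappa>}|" using \<kappa>(3) by (intro card_of_mono1) auto
  also have "|{..<\<kappa>}| =o ord_rel \<kappa>" using cardinal_card_of[OF \<kappa>(1)] .
  also have "ord_rel \<kappa> \<le>o ctwo ^c ord_rel \<kappa>" using inf by (simp add: le_ctwo)
  also have "ctwo ^c ord_rel \<kappa> \<le>o ?T" by (rule le_ctwo[OF Card_order_cexp])
  finally have I: "|{..<\<alpha>}| \<le>o ?T" .
  have le: "|solution_sets \<theta> \<tau> (atomic_fms \<tau> :: _ \<Rightarrow> ('o, 'f, 'p, 'i) fm set) \<beta> M| \<le>o ?T"
    if "\<beta> < \<alpha>" for \<beta>
  proof -
    have \<beta>: "cardinal (b \<beta>)" "r \<le>o ord_rel (b \<beta>)" "b \<beta> \<le> \<kappa>"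
      using is_beth_ge limit that by blast+
    then have "ctwo ^c (ctwo ^c ord_rel (b \<beta>)) \<le>o ?T"
      using \<kappa>(1) r(1) Cinfinite_mono_ord cardinal_le_iff
      by (intro ctwo_mono Cinfinite_ctwo) blast+
    then show ?thesis using limit.IH that ordLeq_transitive by blast
  qed
  have "|\<Union>\<beta>\<in>{..<\<alpha>}. solution_sets \<theta> \<tau> (atomic_fms \<tau> :: _ \<Rightarrow> ('o, 'f, 'p, 'i) fm set) \<beta> M| \<le>o ?T"
    using le by (intro card_of_UNION_le Cinfinite_ctwo inf I) auto
  then show ?case
    using card_of_mono1[OF solution_sets_limit[OF limit.hyps(1)]] ordLeq_transitive by blast
qed

lemma card_of_solution_sets_limit:
  fixes r :: "'x rel"
  assumes \<theta>: "is_limit \<theta>" and \<tau>: "additive_vocab \<theta> \<tau>"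
    and r: "Cinfinite r" "|{..<\<theta>}| \<le>o ctwo ^c r" "|symbols \<tau>| \<le>o ctwo ^c r"
    and \<gamma>: "is_limit \<gamma>" and beth: "is_beth r \<gamma> \<kappa>"
  shows "|solution_sets \<theta> \<tau> (atomic_fms \<tau> :: _ \<Rightarrow> ('o, 'f, 'p, 'i) fm set) \<gamma> M| \<le>o ord_rel \<kappa>"
    and "|{..<\<theta>}| \<le>o ord_rel \<kappa>"
proof -
  have \<kappa>: "cardinal \<kappa>" "r \<le>o ord_rel \<kappa>" "\<gamma> \<le> \<kappa>" using is_beth_ge[OF beth] by auto
  then have inf: "Cinfinite (ord_rel \<kappa>)" using Cinfinite_mono_ord r(1) by blast
  obtain b where b: "\<And>\<beta>. \<beta> < \<gamma> \<Longrightarrow> is_beth r \<beta> (b \<beta>)" "\<And>\<beta>. \<beta> < \<gamma> \<Longrightarrow> b \<beta> \<le> \<kappa>"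
    using beth
  proof cases
    case zero
    then show thesis using \<gamma> not_is_limit_ozero by blast
  next
    case succ
    then show thesis using \<gamma> is_limit_not_succ by blast
  next
    case (limit b)
    then show thesis using that by blast
  qed
  have le: "|solution_sets \<theta> \<tau> (atomic_fms \<tau> :: _ \<Rightarrow> ('o, 'f, 'p, 'i) fm set) \<beta> M| \<le>o ord_rel \<kappa>
      \<and> |{..<\<theta>}| \<le>o ord_rel \<kappa>"
    if \<beta>: "\<beta> < \<gamma>" for \<beta>
  proof -
    obtain \<beta>1 where \<beta>1: "is_succ \<beta> \<beta>1" "\<beta>1 < \<gamma>" using is_limitE[OF \<gamma> \<beta>] .
    obtain \<beta>2 where \<beta>2: "is_succ \<beta>1 \<beta>2" "\<beta>2 < \<gamma>" using is_limitE[OF \<gamma> \<beta>1(2)] .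
    obtain \<kappa>1 where \<kappa>1: "is_beth r \<beta>1 \<kappa>1" "cardinal (b \<beta>2)" "ord_rel (b \<beta>2) =o ctwo ^c ord_rel \<kappa>1"
      using is_beth_succD[OF \<beta>2(1) b(1)[OF \<beta>2(2)]] .
    obtain \<kappa>0 where \<kappa>0: "is_beth r \<beta> \<kappa>0" "ord_rel \<kappa>1 =o ctwo ^c ord_rel \<kappa>0"
      using is_beth_succD[OF \<beta>1(1) \<kappa>1(1)] by metis
    have \<kappa>0': "r \<le>o ord_rel \<kappa>0" "Cinfinite (ord_rel \<kappa>0)"
      using is_beth_ge[OF \<kappa>0(1)] Cinfinite_mono_ord r(1) by auto
    have "ctwo ^c (ctwo ^c ord_rel \<kappa>0) \<le>o ctwo ^c ord_rel \<kappa>1"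
      using \<kappa>0(2) \<kappa>0'(2) by (intro ctwo_mono Cinfinite_ctwo) (auto simp: ordIso_iff_ordLeq)
    also have "ctwo ^c ord_rel \<kappa>1 =o ord_rel (b \<beta>2)" using \<kappa>1(3) by (rule ordIso_symmetric)
    also have "ord_rel (b \<beta>2) \<le>o ord_rel \<kappa>"
      using cardinal_le_iff[OF \<kappa>1(2) \<kappa>(1)] b(2)[OF \<beta>2(2)] by simp
    finally have T: "ctwo ^c (ctwo ^c ord_rel \<kappa>0) \<le>o ord_rel \<kappa>" .
    have le\<theta>: "|{..<\<theta>}| \<le>o ctwo ^c (ctwo ^c ord_rel \<kappa>0)"
      using ordLeq_transitive[OF r(2) ordLeq_transitive[OF ctwo_mono[OF r(1) \<kappa>0'(1)] le_ctwo]]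
        Card_order_cexp by blast
    show ?thesis
      by (rule conjI[OF ordLeq_transitive[OF card_of_solution_sets[OF \<theta> \<tau> r \<kappa>0(1)] T]
            ordLeq_transitive[OF le\<theta> T]])
  qed
  then show "|{..<\<theta>}| \<le>o ord_rel \<kappa>" using ozero_oone(1)[OF \<gamma>] by blast
  have "|{..<\<gamma>}| \<le>o |{..<\<kappa>}|" using \<kappa>(3) by (intro card_of_mono1) auto
  then have "|{..<\<gamma>}| \<le>o ord_rel \<kappa>"
    using cardinal_card_of[OF \<kappa>(1)] ordLeq_ordIso_trans by blast
  then have "|\<Union>\<beta>\<in>{..<\<gamma>}. solution_sets \<theta> \<tau> (atomic_fms \<tau> :: _ \<Rightarrow> ('o, 'f, 'p, 'i) fm set) \<beta> M|
    \<le>o ord_rel \<kappa>"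
    using le by (intro card_of_UNION_le inf) auto
  then show "|solution_sets \<theta> \<tau> (atomic_fms \<tau> :: _ \<Rightarrow> ('o, 'f, 'p, 'i) fm set) \<gamma> M| \<le>o ord_rel \<kappa>"
    using card_of_mono1[OF solution_sets_limit[OF \<gamma>]] ordLeq_transitive by blast
qed

end

section \<open>Convergence\<close>

lemma pe_mono:
  assumes "pe \<theta> B \<alpha> \<eta> \<phi>" and sub: "\<And>\<eta>. B \<eta> \<subseteq> B' \<eta>"
  shows "pe \<theta> B' \<alpha> \<eta> \<phi>"
  using assms(1)
proof induction
  case (zero \<epsilon> \<phi>)
  then show ?case using sub by (blast intro: pe.zero)
qed (blast intro: pe.intros)+

text \<open>There are fewer conditions to test. This reduces the theorem to the case of all atomic
  formulas at level 0 and \<open>UNIV\<close> in place of \<open>\<Phi>\<close>, and thereby covers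
  modules through \<open>linear_fms_atomic\<close>.\<close>

lemma phi_convergent_mono:
  assumes "phi_convergent \<theta> \<tau> B' \<gamma> M \<epsilon> \<chi> \<Phi>' I" and "\<And>\<eta>. B \<eta> \<subseteq> B' \<eta>" and "\<Phi> \<subseteq> \<Phi>'"
  shows "phi_convergent \<theta> \<tau> B \<gamma> M \<epsilon> \<chi> \<Phi> I"
proof -
  have "pe_fms \<theta> B \<gamma> \<eta> \<subseteq> pe_fms \<theta> B' \<gamma> \<eta>" for \<eta>
    unfolding pe_fms_def by (intro subsetI CollectI, drule CollectD, erule pe_mono, rule assms(2))
  then have "\<Phi> \<inter> pe_fms \<theta> B \<gamma> \<eta> \<subseteq> \<Phi>' \<inter> pe_fms \<theta> B' \<gamma> \<eta>" for \<eta>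
    using assms(3) by blast
  then show ?thesis
    using assms(1) unfolding phi_convergent_def by (meson subsetD)
qed

lemma linear_trm_terms:
  assumes "a \<in> seqs \<epsilon> (carrier R)" "finite {\<zeta>. \<zeta> < \<epsilon> \<and> a \<zeta> \<noteq> \<zero>\<^bsub>R\<^esub>}"
  shows "linear_trm R \<epsilon> a \<in> terms (module_vocab R) \<epsilon>"
proof -
  have fold: "foldr (\<lambda>\<zeta> t. Plus (Fn (a \<zeta>) (\<lambda>_\<in>{..<oone}. Var \<zeta>)) t) xs Zero \<in> terms (module_vocab R) \<epsilon>"
    if "set xs \<subseteq> {..<\<epsilon>}" for xs
    using that
  proof (induction xs)
    case (Cons \<zeta> xs)
    then have "a \<zeta> \<in> carrier R" using assms(1) by (auto simp: seqs_def)
    then have "Fn (a \<zeta>) (\<lambda>_\<in>{..<oone}. Var \<zeta>) \<in> terms (module_vocab R) \<epsilon>"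
      using Cons.prems by (intro terms.Fn) (auto simp: module_vocab_def intro: terms.Var)
    then show ?case
      unfolding foldr.simps o_apply using Cons by (intro terms.Plus Cons.IH) simp_all
  qed (simp add: terms.Zero)
  show ?thesis
    unfolding linear_trm_def by (rule fold) (use assms(2) in auto)
qed

lemma linear_fms_atomic: "linear_fms R \<epsilon> \<subseteq> atomic_fms (module_vocab R) \<epsilon>"
  unfolding linear_fms_def atomic_fms_def by (auto intro: linear_trm_terms terms.Zero)

lemma additive_vocab_module: "is_limit \<theta> \<Longrightarrow> additive_vocab \<theta> (module_vocab R)"
  by (simp add: additive_vocab_def module_vocab_def ozero_oone)

lemma (in left_module) smult_zero:
  assumes a: "a \<in> carrier R"
  shows "a \<odot>\<^bsub>M\<^esub> \<zero>\<^bsub>M\<^esub> = \<zero>\<^bsub>M\<^esub>"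
proof -
  have "a \<odot>\<^bsub>M\<^esub> \<zero>\<^bsub>M\<^esub> \<oplus>\<^bsub>M\<^esub> a \<odot>\<^bsub>M\<^esub> \<zero>\<^bsub>M\<^esub> = a \<odot>\<^bsub>M\<^esub> \<zero>\<^bsub>M\<^esub>"
    using smult_r_distr[OF a M.zero_closed M.zero_closed] by simp
  then show ?thesis
    using smult_closed[OF a M.zero_closed] M.r_neg M.minus_equality
    by (metis M.add.r_cancel_one')
qed

lemma (in left_module) smult_minus:
  assumes a: "a \<in> carrier R" and x: "x \<in> carrier M"
  shows "a \<odot>\<^bsub>M\<^esub> (\<ominus>\<^bsub>M\<^esub> x) = \<ominus>\<^bsub>M\<^esub> (a \<odot>\<^bsub>M\<^esub> x)"
proof -
  have "a \<odot>\<^bsub>M\<^esub> (\<ominus>\<^bsub>M\<^esub> x) \<oplus>\<^bsub>M\<^esub> a \<odot>\<^bsub>M\<^esub> x = \<zero>\<^bsub>M\<^esub>"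
    using smult_r_distr[OF a M.a_inv_closed[OF x] x] x by (simp add: M.l_neg smult_zero[OF a])
  then show ?thesis
    using M.minus_equality smult_closed[OF a] x by (metis M.a_inv_closed)
qed

lemma additive_struct_module:
  fixes R :: "'f ring" and N :: "('f, 'm) module"
  assumes "left_module R N" and limit: "is_limit (\<theta> :: 'o::wellorder)"
  shows "additive_struct (module_vocab R :: ('o::wellorder, 'f, 'p) vocab) (module_struct N)"
proof -
  interpret left_module R N by fact
  let ?M = "module_struct N :: ('o, 'f, 'p, 'm) struct"
  let ?G = "group_of ?M"
  have [simp]: "carrier ?G = carrier N" "monoid.mult ?G = add N" "one ?G = \<zero>\<^bsub>N\<^esub>"
    by (simp_all add: group_of_def module_struct_def)
  have G: "comm_group ?G"
    by (rule comm_groupI) (auto simp: M.a_ac intro: M.l_neg M.a_inv_closed)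
  then have grp: "group ?G" by (rule comm_group.axioms)
  have inv [simp]: "inv\<^bsub>?G\<^esub> x = \<ominus>\<^bsub>N\<^esub> x" if "x \<in> carrier N" for x
    using that by (intro group.inv_equality[OF grp]) (auto simp: M.l_neg)
  \<comment> \<open>\<open>oone\<close> differs from \<open>ozero\<close> only if the type has an
    ordinal above 0, which the limit \<open>\<theta>\<close> provides. So argument and value of a
    unary function sit at different coordinates of its graph.\<close>
  have ozero: "ozero < (oone :: 'o)" "ozero \<le> (oone :: 'o)"
    using ozero_oone(3)[OF limit] ozero_least[of "oone :: 'o"] by simp_all
  let ?Q = "product_group {..oone :: 'o} (\<lambda>_. ?G)"
  have "subgroup (fun_graph oone (carrier N) (fun_int ?M a)) ?Q" if a: "a \<in> carrier R" for a
  proof -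
    have graph: "s \<in> fun_graph oone (carrier N) (fun_int ?M a) \<longleftrightarrow>
        s \<in> {..oone} \<rightarrow>\<^sub>E carrier N \<and> a \<odot>\<^bsub>N\<^esub> s ozero = s oone" for s
      using ozero by (auto simp: fun_graph_def module_struct_def seqs_def)
    interpret Q: group ?Q
      by (rule product_group) (rule grp)
    show ?thesis
    proof (rule Q.subgroupI)
      show "fun_graph oone (carrier N) (fun_int ?M a) \<subseteq> carrier ?Q"
        by (auto simp: graph)
      have "(\<lambda>_\<in>{..oone}. \<zero>\<^bsub>N\<^esub>) \<in> fun_graph oone (carrier N) (fun_int ?M a)"
        using ozero by (simp add: graph smult_zero[OF a])
      then show "fun_graph oone (carrier N) (fun_int ?M a) \<noteq> {}" by blast
    next
      fix s assume "s \<in> fun_graph oone (carrier N) (fun_int ?M a)"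
      then have s: "s \<in> {..oone} \<rightarrow>\<^sub>E carrier N" "a \<odot>\<^bsub>N\<^esub> s ozero = s oone" by (simp_all add: graph)
      have "inv\<^bsub>?Q\<^esub> s = (\<lambda>i\<in>{..oone}. \<ominus>\<^bsub>N\<^esub> s i)"
        using s(1) grp by (subst inv_product_group) (auto simp: PiE_iff)
      moreover have "s ozero \<in> carrier N" using s(1) ozero by auto
      ultimately show "inv\<^bsub>?Q\<^esub> s \<in> fun_graph oone (carrier N) (fun_int ?M a)"
        using s ozero by (auto simp: graph smult_minus[OF a])
    next
      fix s t assume "s \<in> fun_graph oone (carrier N) (fun_int ?M a)"
        "t \<in> fun_graph oone (carrier N) (fun_int ?M a)"
      then have s: "s \<in> {..oone} \<rightarrow>\<^sub>E carrier N" "a \<odot>\<^bsub>N\<^esub> s ozero = s oone"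
        and t: "t \<in> {..oone} \<rightarrow>\<^sub>E carrier N" "a \<odot>\<^bsub>N\<^esub> t ozero = t oone" by (simp_all add: graph)
      have "s ozero \<in> carrier N" "t ozero \<in> carrier N" using s(1) t(1) ozero by auto
      then show "s \<otimes>\<^bsub>?Q\<^esub> t \<in> fun_graph oone (carrier N) (fun_int ?M a)"
        using s t ozero by (auto simp: graph smult_r_distr[OF a])
    qed
  qed
  moreover have "universe ?M = carrier N" "minus_int ?M x y = x \<oplus>\<^bsub>N\<^esub> (\<ominus>\<^bsub>N\<^esub> y)"
    "plus_int ?M x y = x \<oplus>\<^bsub>N\<^esub> y"
    "fun_int ?M a s = (if s \<in> seqs oone (carrier N) then Some (a \<odot>\<^bsub>N\<^esub> s ozero) else None)" for x y a s
    by (simp_all add: module_struct_def a_minus_def)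
  moreover have "s ozero \<in> carrier N" if "s \<in> seqs oone (carrier N)" for s :: "'o \<Rightarrow> 'm"
    using that ozero by (auto simp: seqs_def)
  ultimately show ?thesis
    unfolding additive_struct_def using G smult_closed
    by (simp add: module_vocab_def split: if_splits)
qed

section \<open>Congruence modulo a solution set\<close>

context additive
begin

text \<open>This is x - y followed by zeros; its membership in a solution set is the congruence of
  \<open>x\<close> and \<open>y\<close>. Written out directly, it avoids the \<open>THE\<close> in
  \<open>seq_append\<close>.\<close>

definition pad_diff :: "'o \<Rightarrow> 'o \<Rightarrow> ('o \<Rightarrow> 'm) \<Rightarrow> ('o \<Rightarrow> 'm) \<Rightarrow> 'o \<Rightarrow> 'm"
  where "pad_diff \<epsilon> \<eta> x y = (\<lambda>k\<in>{..<\<eta>}. if k < \<epsilon> then x k -\<^sub>M y k else zero_int M)"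

lemma pad_diff_self: "x \<in> seqs \<epsilon> U \<Longrightarrow> pad_diff \<epsilon> \<eta> x x = (\<lambda>k\<in>{..<\<eta>}. zero_int M)"
  by (auto simp: pad_diff_def fun_eq_iff seqs_def PiE_iff)

text \<open>Symmetry and transitivity of congruence are expressed by zero and differences, since
  these are what \<open>diff_closed_solutions\<close> supplies.\<close>

lemma pad_diff_swap:
  "x \<in> seqs \<epsilon> U \<Longrightarrow> y \<in> seqs \<epsilon> U \<Longrightarrow>
    pad_diff \<epsilon> \<eta> y x = seq_diff M \<eta> (\<lambda>k\<in>{..<\<eta>}. zero_int M) (pad_diff \<epsilon> \<eta> x y)"
  by (auto simp: pad_diff_def seq_diff_def fun_eq_iff seqs_def PiE_iff zero_minus_minus)

lemma pad_diff_trans: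
  "x \<in> seqs \<epsilon> U \<Longrightarrow> y \<in> seqs \<epsilon> U \<Longrightarrow> z \<in> seqs \<epsilon> U \<Longrightarrow>
    pad_diff \<epsilon> \<eta> x z = seq_diff M \<eta> (pad_diff \<epsilon> \<eta> x y) (pad_diff \<epsilon> \<eta> z y)"
  by (auto simp: pad_diff_def seq_diff_def fun_eq_iff seqs_def PiE_iff minus_cancel_right)

context
  fixes \<theta> \<epsilon> \<xi> :: 'o and b c x y :: "'o \<Rightarrow> 'm"
  assumes \<theta>: "regular_cardinal \<theta>" and \<epsilon>: "\<epsilon> < \<theta>" and \<xi>: "\<xi> < \<theta>"
    and x: "x \<in> seqs \<epsilon> U" and y: "y \<in> seqs \<epsilon> U" and b: "b \<in> seqs \<xi> U"
    and c: "c \<in> seqs (oadd \<epsilon> \<xi>) U"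
begin

private lemma components:
  assumes "k < oadd \<epsilon> \<xi>"
  shows "c k \<in> U" and "k < \<epsilon> \<Longrightarrow> x k \<in> U" and "k < \<epsilon> \<Longrightarrow> y k \<in> U"
    and "k < \<epsilon> \<Longrightarrow> seq_append \<epsilon> \<xi> z b k = z k"
    and "\<not> k < \<epsilon> \<Longrightarrow> seq_append \<epsilon> \<xi> z b k \<in> U"
    and "\<not> k < \<epsilon> \<Longrightarrow> seq_append \<epsilon> \<xi> x b k = seq_append \<epsilon> \<xi> y b k"
  using assms x y c seq_append_left[OF assms] seq_append_right[OF \<theta> \<epsilon> \<xi> b]
  by (auto simp: seqs_def not_less seq_append_def)

text \<open>The common tail \<open>b\<close> and the translation \<open>c\<close> cancel, so two
  sequences whose translates both lie in a subgroup are congruent modulo it.\<close>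

lemma pad_diff_append:
  "pad_diff \<epsilon> (oadd \<epsilon> \<xi>) x y = seq_diff M (oadd \<epsilon> \<xi>)
    (seq_diff M (oadd \<epsilon> \<xi>) (seq_append \<epsilon> \<xi> x b) c) (seq_diff M (oadd \<epsilon> \<xi>) (seq_append \<epsilon> \<xi> y b) c)"
proof
  fix k
  show "pad_diff \<epsilon> (oadd \<epsilon> \<xi>) x y k = seq_diff M (oadd \<epsilon> \<xi>)
    (seq_diff M (oadd \<epsilon> \<xi>) (seq_append \<epsilon> \<xi> x b) c)
    (seq_diff M (oadd \<epsilon> \<xi>) (seq_append \<epsilon> \<xi> y b) c) k"
    using components[of k]
    by (cases "k < oadd \<epsilon> \<xi>"; cases "k < \<epsilon>") (simp_all add: pad_diff_def seq_diff_def minus_cancel_right)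
qed

text \<open>The converse direction: subtracting an element of the subgroup transports membership of
  the translate from \<open>y\<close> to \<open>x\<close>.\<close>

lemma append_pad_diff:
  "seq_diff M (oadd \<epsilon> \<xi>) (seq_append \<epsilon> \<xi> x b) c = seq_diff M (oadd \<epsilon> \<xi>)
    (seq_diff M (oadd \<epsilon> \<xi>) (seq_append \<epsilon> \<xi> y b) c) (pad_diff \<epsilon> (oadd \<epsilon> \<xi>) y x)"
proof
  fix k
  show "seq_diff M (oadd \<epsilon> \<xi>) (seq_append \<epsilon> \<xi> x b) c k = seq_diff M (oadd \<epsilon> \<xi>)
    (seq_diff M (oadd \<epsilon> \<xi>) (seq_append \<epsilon> \<xi> y b) c) (pad_diff \<epsilon> (oadd \<epsilon> \<xi>) y x) k"
    using components[of k]
    by (cases "k < oadd \<epsilon> \<xi>"; cases "k < \<epsilon>") (simp_all add: pad_diff_def seq_diff_def minus_cancel_left)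
qed

end

lemma stationary_convergent:
  fixes \<theta> \<gamma> \<kappa> \<epsilon> \<mu> lam :: 'o and a :: "'o \<Rightarrow> 'o \<Rightarrow> 'm"
  assumes \<theta>: "regular_cardinal \<theta>" and \<tau>: "additive_vocab \<theta> \<tau>" and \<gamma>: "is_limit \<gamma>"
    and beth: "is_beth ( |symbols \<tau>| +c ord_rel (card_pred \<theta>)) \<gamma> \<kappa>"
    and \<epsilon>: "\<epsilon> < \<theta>" and \<mu>: "cardinal \<mu>" "\<kappa> \<le> \<mu>" and lam: "regular_cardinal lam" "\<mu> < lam"
    and pow: "\<forall>i<lam. |{..<i}| ^c ord_rel \<kappa> <o ord_rel lam"
    and a: "a ` {..<lam} \<subseteq> seqs \<epsilon> U" "inj_on a {..<lam}"
  shows "\<exists>S. stationary lam S \<and> phi_convergent \<theta> \<tau> (atomic_fms \<tau> :: 'o \<Rightarrow> ('o, 'f, 'p, 'i) fm set)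
    \<gamma> M \<epsilon> (cardSuc (ord_rel \<mu>)) UNIV (a ` S)"
proof -
  let ?B = "atomic_fms \<tau> :: 'o \<Rightarrow> ('o, 'f, 'p, 'i) fm set"
  let ?r = "|symbols \<tau>| +c ord_rel (card_pred \<theta>)"
  have c\<theta>: "cardinal \<theta>" "infinite {..<\<theta>}" using \<theta> by (auto simp: regular_cardinal_def)
  have lim: "is_limit \<theta>" by (rule is_limit_cardinal[OF c\<theta>])
  have pred: "Cinfinite (ord_rel (card_pred \<theta>))" by (rule card_pred_props(1)[OF \<theta>])
  have r: "Cinfinite ?r" using pred by (intro Cinfinite_csum disjI2)
  have "ctwo ^c ord_rel (card_pred \<theta>) \<le>o ctwo ^c ?r"
    using pred by (intro ctwo_mono ordLeq_csum2) auto
  then have r\<theta>: "|{..<\<theta>}| \<le>o ctwo ^c ?r"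
    using card_pred_props(2)[OF \<theta>] cardinal_card_of[OF c\<theta>(1)] ordLeq_transitive
      ordIso_ordLeq_trans by blast
  have "?r \<le>o ctwo ^c ?r" using r by (simp add: le_ctwo)
  then have r\<tau>: "|symbols \<tau>| \<le>o ctwo ^c ?r"
    by (rule ordLeq_transitive[OF ordLeq_csum1[OF card_of_Card_order]])
  have \<kappa>: "cardinal \<kappa>" "?r \<le>o ord_rel \<kappa>" using is_beth_ge[OF beth] by auto
  have inf: "Cinfinite (ord_rel \<kappa>)" by (rule Cinfinite_mono_ord[OF r \<kappa>])
  note sizes = card_of_solution_sets_limit[OF lim \<tau> r r\<theta> r\<tau> \<gamma> beth]
  \<comment> \<open>\<open>\<xi>\<close> is kept beside the solution set because the number of
    padding zeros depends on it.\<close>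
  define H where "H = {(\<xi>, X). \<xi> < \<theta> \<and> (\<exists>\<phi> :: ('o, 'f, 'p, 'i) fm.
    pe \<theta> ?B \<gamma> (oadd \<epsilon> \<xi>) \<phi> \<and> X = solutions \<tau> M (oadd \<epsilon> \<xi>) \<phi>)}"
  have "H \<subseteq> {..<\<theta>} \<times> solution_sets \<theta> \<tau> ?B \<gamma> M"
    unfolding H_def solution_sets_def by blast
  then have "|H| \<le>o |{..<\<theta>} \<times> solution_sets \<theta> \<tau> ?B \<gamma> M|" by (rule card_of_mono1)
  also have "|{..<\<theta>} \<times> solution_sets \<theta> \<tau> ?B \<gamma> M| \<le>o ord_rel \<kappa>"
    by (rule card_of_Times_le[OF inf sizes(2,1)])
  finally have cardH: "|H| \<le>o ord_rel \<kappa>" .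
  define E where "E = (\<lambda>(\<xi>, X) i j. pad_diff \<epsilon> (oadd \<epsilon> \<xi>) (a i) (a j) \<in> X)"
  have aU: "a i \<in> seqs \<epsilon> U" if "i < lam" for i using a(1) that by auto
  have closed: "(\<lambda>i\<in>{..<oadd \<epsilon> \<xi>}. zero_int M) \<in> X"
    "x \<in> X \<Longrightarrow> y \<in> X \<Longrightarrow> seq_diff M (oadd \<epsilon> \<xi>) x y \<in> X" if "(\<xi>, X) \<in> H" for \<xi> X x y
    using that diff_closed_solutions[OF diff_closed_pe] unfolding H_def by blast+
  have "\<exists>S. stationary lam S \<and>
    (\<forall>h\<in>H. (\<forall>i\<in>S. \<forall>j\<in>S. E h i j) \<or> (\<forall>i\<in>S. \<forall>j\<in>S. i \<noteq> j \<longrightarrow> \<not> E h i j))"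
  proof (rule stationary_homogeneous[OF lam(1) \<kappa>(1) _ pow cardH])
    show "infinite {..<\<kappa>}" using inf by (simp add: cinfinite_def)
    fix h assume "h \<in> H"
    then obtain \<xi> X where h: "h = (\<xi>, X)" "(\<xi>, X) \<in> H" by (cases h) auto
    show "E h i i" if "i < lam" for i
      using closed(1)[OF h(2)] by (simp add: h(1) E_def pad_diff_self[OF aU[OF that]])
    have Eh: "E h i j \<longleftrightarrow> pad_diff \<epsilon> (oadd \<epsilon> \<xi>) (a i) (a j) \<in> X" for i j
      by (simp add: h(1) E_def)
    show sym: "E h j i" if "i < lam" "j < lam" "E h i j" for i j
      unfolding Eh pad_diff_swap[OF aU[OF that(1)] aU[OF that(2)]]
      by (rule closed(2)[OF h(2) closed(1)[OF h(2)] that(3)[unfolded Eh]])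
    show "E h i k" if "i < lam" "j < lam" "k < lam" "E h i j" "E h j k" for i j k
      unfolding Eh pad_diff_trans[OF aU[OF that(1)] aU[OF that(2)] aU[OF that(3)]]
      by (rule closed(2)[OF h(2) that(4)[unfolded Eh] sym[OF that(2,3,5), unfolded Eh]])
  qed
  then obtain S where S: "stationary lam S"
    and hom: "\<And>h. h \<in> H \<Longrightarrow>
      (\<forall>i\<in>S. \<forall>j\<in>S. E h i j) \<or> (\<forall>i\<in>S. \<forall>j\<in>S. i \<noteq> j \<longrightarrow> \<not> E h i j)" by blast
  have Slam: "S \<subseteq> {..<lam}" using S by (simp add: stationary_def)
  have co\<mu>: "Card_order (ord_rel \<mu>)" using \<mu>(1) by (simp add: cardinal_def)
  have "infinite {..<\<mu>}"
    using inf \<mu>(2) finite_subset[of "{..<\<kappa>}" "{..<\<mu>}"] by (auto simp: cinfinite_def)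
  then have inf\<mu>: "infinite (Field (cardSuc (ord_rel \<mu>)))" by (simp add: cardSuc_finite[OF co\<mu>])
  have small: "|A| <o cardSuc (ord_rel \<mu>)" if "finite A" for A :: "('o \<Rightarrow> 'm) set"
    using finite_ordLess_infinite[OF card_of_Well_order cardSuc_Well_order[OF co\<mu>]] inf\<mu> that
    by (simp add: Field_card_of)
  have "|a ` S| =o |S|"
    using ordIso_symmetric[OF card_of_ordIsoI[OF inj_on_imp_bij_betw[OF inj_on_subset[OF a(2) Slam]]]] .
  then have cardS: "|a ` S| =o ord_rel lam"
    using card_of_stationary[OF lam(1) S] ordIso_transitive by blast
  have "ord_rel \<mu> <o ord_rel lam"
    using cardinal_less \<mu>(1) lam by (auto simp: regular_cardinal_def)
  then have "ord_rel \<mu> <o |a ` S|"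
    using cardS ordIso_symmetric ordLess_ordIso_trans by blast
  then have large: "cardSuc (ord_rel \<mu>) \<le>o |a ` S|"
    by (rule cardSuc_least[OF co\<mu> card_of_Card_order])
  have "\<exists>v. |{x \<in> a ` S. (seq_diff M (oadd \<epsilon> \<xi>) (seq_append \<epsilon> \<xi> x b) c
      \<in> solutions \<tau> M (oadd \<epsilon> \<xi>) \<phi>) \<noteq> v}| <o cardSuc (ord_rel \<mu>)"
    if \<xi>: "\<xi> < \<theta>" and \<phi>: "\<phi> \<in> pe_fms \<theta> ?B \<gamma> (oadd \<epsilon> \<xi>)"
      and b: "b \<in> seqs \<xi> U" and c: "c \<in> seqs (oadd \<epsilon> \<xi>) U" for \<xi> \<phi> b c
  proof -
    define X where "X = solutions \<tau> M (oadd \<epsilon> \<xi>) \<phi>"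
    let ?D = "\<lambda>x. seq_diff M (oadd \<epsilon> \<xi>) (seq_append \<epsilon> \<xi> x b) c \<in> X"
    have H: "(\<xi>, X) \<in> H" using \<xi> \<phi> by (auto simp: H_def X_def pe_fms_def)
    have aS: "a i \<in> seqs \<epsilon> U" if "i \<in> S" for i using aU Slam that by blast
    have DE: "E (\<xi>, X) i j" if "i \<in> S" "j \<in> S" "?D (a i)" "?D (a j)" for i j
      unfolding E_def prod.case pad_diff_append[OF \<theta> \<epsilon> \<xi> aS[OF that(1)] aS[OF that(2)] b c]
      by (rule closed(2)[OF H that(3,4)])
    have ED: "?D (a i)" if "i \<in> S" "j \<in> S" "?D (a j)" "E (\<xi>, X) j i" for i j
      by (subst append_pad_diff[OF \<theta> \<epsilon> \<xi> aS[OF that(1)] aS[OF that(2)] b c])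
        (rule closed(2)[OF H that(3) that(4)[unfolded E_def prod.case]])
    \<comment> \<open>\<open>v\<close> is \<open>True\<close> if some translate lies in
      \<open>X\<close> and all members of \<open>S\<close> are congruent, and \<open>False\<close>
      otherwise. The exceptional set is empty or the singleton of the one sequence whose translate
      lies in \<open>X\<close>.\<close>
    have "\<exists>v. finite {x \<in> a ` S. ?D x \<noteq> v}"
    proof (cases "\<exists>i\<in>S. ?D (a i)")
      case True
      then obtain i where i: "i \<in> S" "?D (a i)" by blast
      show ?thesis
        using hom[OF H]
      proof
        assume "\<forall>i\<in>S. \<forall>j\<in>S. E (\<xi>, X) i j"
        then have "?D (a j)" if "j \<in> S" for j using ED[OF that i] i(1) that by blast
        then have "{x \<in> a ` S. ?D x \<noteq> True} = {}" by auto
        then have "finite {x \<in> a ` S. ?D x \<noteq> True}" by (simp only: finite.emptyI)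
        then show ?thesis ..
      next
        assume "\<forall>i\<in>S. \<forall>j\<in>S. i \<noteq> j \<longrightarrow> \<not> E (\<xi>, X) i j"
        then have "j = i" if "j \<in> S" "?D (a j)" for j using DE[OF that(1) i(1) that(2) i(2)] i(1) that(1) by blast
        then have "{x \<in> a ` S. ?D x \<noteq> False} \<subseteq> {a i}" by auto
        then have "finite {x \<in> a ` S. ?D x \<noteq> False}" by (rule finite_subset) simp
        then show ?thesis ..
      qed
    next
      case False
      then have "{x \<in> a ` S. ?D x \<noteq> False} = {}" by auto
      then have "finite {x \<in> a ` S. ?D x \<noteq> False}" by (simp only: finite.emptyI)
      then show ?thesis ..
    qed
    then show ?thesis unfolding X_def using small by blast
  qed
  then have "phi_convergent \<theta> \<tau> ?B \<gamma> M \<epsilon> (cardSuc (ord_rel \<mu>)) UNIV (a ` S)"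
    unfolding phi_convergent_def using large a(1) Slam by blast
  then show ?thesis using S by blast
qed

end

theorem claim3p5:
  fixes \<theta> \<gamma> \<kappa> \<epsilon> \<mu> lam :: "'o::wellorder"
    and \<tau> :: "('o, 'f, 'p) vocab"
    and M :: "('o, 'f, 'p, 'm) struct"
    and \<Lambda>\<^sub>0 :: "'o \<Rightarrow> ('o, 'f, 'p, 'i) fm set"
    and \<Phi> :: "('o, 'f, 'p, 'i) fm set"
    and a :: "'o \<Rightarrow> 'o \<Rightarrow> 'm"
  assumes "regular_cardinal \<theta>"
    and "(\<exists>(R :: 'f ring) (N :: ('f, 'm) module). left_module R N \<and>
            \<tau> = module_vocab R \<and> M = module_struct N \<and> \<Lambda>\<^sub>0 = linear_fms R) \<or>
         (additive_vocab \<theta> \<tau> \<and> additive_struct \<tau> M \<and> \<Lambda>\<^sub>0 = atomic_fms \<tau>)"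
    and "is_limit \<gamma>"
    and "is_beth ( |symbols \<tau>| +c ord_rel (card_pred \<theta>)) \<gamma> \<kappa>"
    and "\<Phi> \<subseteq> (\<Union>\<epsilon>\<in>{..<\<theta>}. pe_fms \<theta> \<Lambda>\<^sub>0 \<gamma> \<epsilon>)"
    and "\<epsilon> < \<theta>"
    and "cardinal \<mu>" and "\<kappa> \<le> \<mu>"
    and "regular_cardinal lam" and "\<mu> < lam"
    and "\<forall>i<lam. |{..<i}| ^c ord_rel \<kappa> <o ord_rel lam"
    and "a ` {..<lam} \<subseteq> seqs \<epsilon> (universe M)" and "inj_on a {..<lam}"
  shows "\<exists>S. stationary lam S \<and> phi_convergent \<theta> \<tau> \<Lambda>\<^sub>0 \<gamma> M \<epsilon> (cardSuc (ord_rel \<mu>)) \<Phi> (a ` S)"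
proof -
  have lim: "is_limit \<theta>"
    using assms(1) is_limit_cardinal by (auto simp: regular_cardinal_def)
  \<comment> \<open>What both alternatives of the assumption have in common: an additive structure
    whose level-0 formulas are among the atomic ones.\<close>
  have "additive_vocab \<theta> \<tau> \<and> additive_struct \<tau> M \<and> (\<forall>\<eta>. \<Lambda>\<^sub>0 \<eta> \<subseteq> atomic_fms \<tau> \<eta>)"
    using assms(2)
  proof (elim disjE exE conjE)
    fix R :: "'f ring" and N :: "('f, 'm) module"
    assume "left_module R N" "\<tau> = module_vocab R" "M = module_struct N" "\<Lambda>\<^sub>0 = linear_fms R"
    then show ?thesis
      by (simp add: additive_vocab_module[OF lim] additive_struct_module[OF _ lim] linear_fms_atomic)
  qed simp
  then have \<tau>: "additive_vocab \<theta> \<tau>" and M: "additive_struct \<tau> M"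
    and sub: "\<And>\<eta>. \<Lambda>\<^sub>0 \<eta> \<subseteq> atomic_fms \<tau> \<eta>"
    by auto
  interpret additive \<tau> M by (rule additive.intro[OF M])
  obtain S where S: "stationary lam S" and conv: "phi_convergent \<theta> \<tau>
      (atomic_fms \<tau> :: 'o \<Rightarrow> ('o, 'f, 'p, 'i) fm set) \<gamma> M \<epsilon> (cardSuc (ord_rel \<mu>)) UNIV (a ` S)"
    using stationary_convergent[OF assms(1) \<tau> assms(3,4,6-13)] by blast
  have "phi_convergent \<theta> \<tau> \<Lambda>\<^sub>0 \<gamma> M \<epsilon> (cardSuc (ord_rel \<mu>)) \<Phi> (a ` S)"
    by (rule phi_convergent_mono[OF conv _ subset_UNIV]) (rule sub)
  then show ?thesis using S by blast
qed

end
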